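(* Any ordered functor $\phi : G \to H$ of ordered groupoids admits a canonical factorization as the composition of a fibration, followed by an enlargement, followed by a covering: $$G \xrightarrow{\ \varpi\ } G/\!/\ker\phi \xrightarrow{\ i\ } \widetilde{H}_\psi \xrightarrow{\ \pi\ } H,$$ where $\psi: G/\!/\ker\phi\to H$ is the star-injective ordered functor $[g]\mapsto g\phi$, and $\widetilde{H}_\psi$, $i$, $\pi$ are as defined in the context.
   Context: Conventions: a groupoid $G$ is a small category in which every morphism is invertible, identified with its set of arrows under partial composition; $G_0\subseteq G$ is its set of identities. An arrow $g$ has domain $g\mathbf{d}=gg^{-1}$ and range $g\mathbf{r}=g^{-1}g$, and $gh$ is defined iff $g\mathbf{r}=h\mathbf{d}$. Maps are written on the right and composed from left to right. For $e\in G_0$, $\mathrm{star}_G(e)=\{g: g\mathbf{d}=e\}$. A functor is star-surjective (-injective, -bijective) if all its restrictions to stars are surjective (injective, bijective). $\ker\phi=\{g\in G: g\phi\in H_0\}$. An ordered groupoid is a groupoid $G$ with a partial order $\leq$ on arrows such that: (OG1) $g\leq h$ implies $g^{-1}\leq h^{-1}$; (OG2) if $g_1\leq g_2$, $h_1\leq h_2$ and $g_1h_1$, $g_2h_2$ are defined, then $g_1h_1\leq g_2h_2$; (OG3) if $g\in G$, $f\in G_0$ and $f\leq g\mathbf{d}$, there is a unique $(f|g)\leq g$ with domain $f$. If $f\in G_0$, $f\leq g\mathbf{r}$, put $(g|f)=(f|g^{-1})^{-1}$. Ordered functors are order-preserving functors. A fibration is a star-surjective ordered functor; a covering is a star-bijective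 ordered functor. An enlargement of ordered groupoids is an inclusion of a subgroupoid $A\hookrightarrow B$ such that $A_0$ is an order ideal in $B_0$; if $b\in B$ and $b\mathbf{d},b\mathbf{r}\in A$ then $b\in A$; and for every $e\in B_0$ there is $b\in B$ with $b\mathbf{d}=e$ and $b\mathbf{r}\in A_0$. An ordered embedding $i:U\to B$ is an enlargement when $Ui\hookrightarrow B$ is. Quotient: put $A=\ker\phi$. Define $g\simeq_A h$ iff there are $a,b,c,d\in A$ with $agb\leq h$ and $chd\leq g$; this is an equivalence relation with classes $[g]$, and $G/\!/A$ is the set of classes, ordered by $[g]\leq[k]$ iff $agb\leq k$ for some $a,b\in A$. For $e,f\in G_0$ an $A$-nexus between $e$ and $f$ is a pair $(a,p)$ in $A$ with $aa^{-1}\leq e$, $a^{-1}a=f$, $pp^{-1}\leq f$, $p^{-1}p=e$. $[g][h]$ is defined iff $g^{-1}g\simeq_A hh^{-1}$, and then $[g][h]=[(g|aa^{-1})ah]$ for any $A$-nexus $(a,p)$ between $g^{-1}g$ and $hh^{-1}$. This makes $G/\!/A$ an ordered groupoid; $\varpi: g\mapsto[g]$. Construction of $\widetilde{H}_\psi$: let $\psi:U\to H$ be a star-injective ordered functor (here $U=G/\!/\ker\phi$). Let $\Omega H$ be the poset of arrows of $H$, and $U_0\boxtimes\Omega H=\{(e,h)\in U_0\times H: e\psi=h\mathbf{d}\}$. Define $(e,h)\equiv_U(f,k)$ iff there is $u\in U$ with $u\mathbf{d}=e$, $u\mathbf{r}=f$ and $h=(u\psi)k$; write $e\otimes h$ for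 the class of $(e,h)$ and $U_0\otimes\Omega H$ for the set of classes. It is a poset under: $f\otimes h\leq e\otimes k$ iff $f\otimes h=x\otimes l$ for some $x\leq e$ and $l\leq k$. $H$ acts on it on the right by $(e\otimes h)\lhd m=e\otimes hm$, defined when $h\mathbf{r}=m\mathbf{d}$. Then $\widetilde{H}_\psi=H\ltimes(U_0\otimes\Omega H)$ is the ordered groupoid with arrows the pairs $(k,e\otimes h)$ with $k\mathbf{r}=h\mathbf{r}$, object set identified with $U_0\otimes\Omega H$, $(k,e\otimes h)\mathbf{d}=e\otimes hk^{-1}$, $(k,e\otimes h)\mathbf{r}=e\otimes h$, composition $(k,e\otimes h)(m,f\otimes l)=(km,f\otimes l)$ when $e\otimes h=f\otimes lm^{-1}$, and componentwise order. The functor $i:U\to\widetilde{H}_\psi$ is $u\mapsto(u\psi,\,u\mathbf{d}\otimes u\psi)$, and $\pi:\widetilde{H}_\psi\to H$ is $(k,e\otimes h)\mapsto k$. *)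

theory Defs
  imports Main
begin

section \<open>Ordered groupoids\<close>

text \<open>
  Categories are arrows-only: an object is identified with its identity arrow, so
  \<open>Dom\<close> and \<open>Ran\<close> return identity arrows. Composition is written from left to right;
  \<open>g \<cdot> h\<close> is meaningful only when \<open>Ran g = Dom h\<close>, and the values of all operations
  outside these domains are irrelevant.
\<close>

record 'a ogpd =
  Arr :: "'a set"
  Dom :: "'a \<Rightarrow> 'a"
  Ran :: "'a \<Rightarrow> 'a"
  Comp :: "'a \<Rightarrow> 'a \<Rightarrow> 'a"  (infixl "\<cdot>\<index>" 70)
  Leq :: "'a \<Rightarrow> 'a \<Rightarrow> bool"  (infix "\<preceq>\<index>" 50)

definition Idents :: "'a ogpd \<Rightarrow> 'a set" where
  "Idents G = {e \<in> Arr G. Dom G e = e}"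

definition is_inverse :: "'a ogpd \<Rightarrow> 'a \<Rightarrow> 'a \<Rightarrow> bool" where
  "is_inverse G g h \<longleftrightarrow>
     h \<in> Arr G \<and> Dom G h = Ran G g \<and> Ran G h = Dom G g \<and>
     g \<cdot>\<^bsub>G\<^esub> h = Dom G g \<and> h \<cdot>\<^bsub>G\<^esub> g = Ran G g"

definition Inv :: "'a ogpd \<Rightarrow> 'a \<Rightarrow> 'a" where
  "Inv G g = (THE h. is_inverse G g h)"

locale groupoid =
  fixes G :: "'a ogpd" (structure)
  assumes Dom_closed: "g \<in> Arr G \<Longrightarrow> Dom G g \<in> Arr G"
    and Ran_closed: "g \<in> Arr G \<Longrightarrow> Ran G g \<in> Arr G"
    and Dom_Dom: "g \<in> Arr G \<Longrightarrow> Dom G (Dom G g) = Dom G g"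
    and Ran_Dom: "g \<in> Arr G \<Longrightarrow> Ran G (Dom G g) = Dom G g"
    and Dom_Ran: "g \<in> Arr G \<Longrightarrow> Dom G (Ran G g) = Ran G g"
    and Ran_Ran: "g \<in> Arr G \<Longrightarrow> Ran G (Ran G g) = Ran G g"
    and Comp_closed: "\<lbrakk>g \<in> Arr G; h \<in> Arr G; Ran G g = Dom G h\<rbrakk> \<Longrightarrow> g \<cdot> h \<in> Arr G"
    and Dom_Comp: "\<lbrakk>g \<in> Arr G; h \<in> Arr G; Ran G g = Dom G h\<rbrakk> \<Longrightarrow> Dom G (g \<cdot> h) = Dom G g"
    and Ran_Comp: "\<lbrakk>g \<in> Arr G; h \<in> Arr G; Ran G g = Dom G h\<rbrakk> \<Longrightarrow> Ran G (g \<cdot> h) = Ran G h"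
    and Comp_Dom: "g \<in> Arr G \<Longrightarrow> Dom G g \<cdot> g = g"
    and Comp_Ran: "g \<in> Arr G \<Longrightarrow> g \<cdot> Ran G g = g"
    and Comp_assoc: "\<lbrakk>g \<in> Arr G; h \<in> Arr G; k \<in> Arr G; Ran G g = Dom G h; Ran G h = Dom G k\<rbrakk>
      \<Longrightarrow> (g \<cdot> h) \<cdot> k = g \<cdot> (h \<cdot> k)"
    and inverse_exists: "g \<in> Arr G \<Longrightarrow> \<exists>h. is_inverse G g h"

locale ordered_groupoid = groupoid G for G :: "'a ogpd" (structure) +
  assumes Leq_refl: "g \<in> Arr G \<Longrightarrow> g \<preceq> g"
    and Leq_antisym: "\<lbrakk>g \<in> Arr G; h \<in> Arr G; g \<preceq> h; h \<preceq> g\<rbrakk> \<Longrightarrow> g = h"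
    and Leq_trans: "\<lbrakk>g \<in> Arr G; h \<in> Arr G; k \<in> Arr G; g \<preceq> h; h \<preceq> k\<rbrakk> \<Longrightarrow> g \<preceq> k"
    and OG1: "\<lbrakk>g \<in> Arr G; h \<in> Arr G; g \<preceq> h\<rbrakk> \<Longrightarrow> Inv G g \<preceq> Inv G h"
    and OG2: "\<lbrakk>g1 \<in> Arr G; g2 \<in> Arr G; h1 \<in> Arr G; h2 \<in> Arr G; g1 \<preceq> g2; h1 \<preceq> h2;
       Ran G g1 = Dom G h1; Ran G g2 = Dom G h2\<rbrakk> \<Longrightarrow> g1 \<cdot> h1 \<preceq> g2 \<cdot> h2"
    and OG3: "\<lbrakk>g \<in> Arr G; f \<in> Idents G; f \<preceq> Dom G g\<rbrakk>
       \<Longrightarrow> \<exists>!x. x \<in> Arr G \<and> x \<preceq> g \<and> Dom G x = f"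

definition restr :: "'a ogpd \<Rightarrow> 'a \<Rightarrow> 'a \<Rightarrow> 'a" where
  "restr G f g = (THE x. x \<in> Arr G \<and> x \<preceq>\<^bsub>G\<^esub> g \<and> Dom G x = f)"

definition corestr :: "'a ogpd \<Rightarrow> 'a \<Rightarrow> 'a \<Rightarrow> 'a" where
  "corestr G g f = Inv G (restr G f (Inv G g))"

section \<open>Ordered functors\<close>

locale ordered_functor =
  G: ordered_groupoid G + H: ordered_groupoid H
  for G :: "'a ogpd" and H :: "'b ogpd" +
  fixes \<phi> :: "'a \<Rightarrow> 'b"
  assumes map_closed: "g \<in> Arr G \<Longrightarrow> \<phi> g \<in> Arr H"
    and map_Dom: "g \<in> Arr G \<Longrightarrow> \<phi> (Dom G g) = Dom H (\<phi> g)"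
    and map_Ran: "g \<in> Arr G \<Longrightarrow> \<phi> (Ran G g) = Ran H (\<phi> g)"
    and map_Comp: "\<lbrakk>g \<in> Arr G; h \<in> Arr G; Ran G g = Dom G h\<rbrakk>
      \<Longrightarrow> \<phi> (g \<cdot>\<^bsub>G\<^esub> h) = \<phi> g \<cdot>\<^bsub>H\<^esub> \<phi> h"
    and map_Leq: "\<lbrakk>g \<in> Arr G; h \<in> Arr G; g \<preceq>\<^bsub>G\<^esub> h\<rbrakk> \<Longrightarrow> \<phi> g \<preceq>\<^bsub>H\<^esub> \<phi> h"

definition star :: "'a ogpd \<Rightarrow> 'a \<Rightarrow> 'a set" where
  "star G e = {g \<in> Arr G. Dom G g = e}"

definition star_surjective :: "'a ogpd \<Rightarrow> 'b ogpd \<Rightarrow> ('a \<Rightarrow> 'b) \<Rightarrow> bool" where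
  "star_surjective G H \<phi> \<longleftrightarrow> (\<forall>e \<in> Idents G. \<phi> ` star G e = star H (\<phi> e))"

definition star_injective :: "'a ogpd \<Rightarrow> ('a \<Rightarrow> 'b) \<Rightarrow> bool" where
  "star_injective G \<phi> \<longleftrightarrow> (\<forall>e \<in> Idents G. inj_on \<phi> (star G e))"

definition star_bijective :: "'a ogpd \<Rightarrow> 'b ogpd \<Rightarrow> ('a \<Rightarrow> 'b) \<Rightarrow> bool" where
  "star_bijective G H \<phi> \<longleftrightarrow> (\<forall>e \<in> Idents G. bij_betw \<phi> (star G e) (star H (\<phi> e)))"

definition fibration :: "'a ogpd \<Rightarrow> 'b ogpd \<Rightarrow> ('a \<Rightarrow> 'b) \<Rightarrow> bool" where
  "fibration G H \<phi> \<longleftrightarrow> ordered_functor G H \<phi> \<and> star_surjective G H \<phi>"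

definition covering :: "'a ogpd \<Rightarrow> 'b ogpd \<Rightarrow> ('a \<Rightarrow> 'b) \<Rightarrow> bool" where
  "covering G H \<phi> \<longleftrightarrow> ordered_functor G H \<phi> \<and> star_bijective G H \<phi>"

definition kernel :: "'a ogpd \<Rightarrow> 'b ogpd \<Rightarrow> ('a \<Rightarrow> 'b) \<Rightarrow> 'a set" where
  "kernel G H \<phi> = {g \<in> Arr G. \<phi> g \<in> Idents H}"

section \<open>Enlargements\<close>

definition subgroupoid :: "'a set \<Rightarrow> 'a ogpd \<Rightarrow> bool" where
  "subgroupoid A B \<longleftrightarrow>
     A \<subseteq> Arr B \<and>
     (\<forall>a \<in> A. Dom B a \<in> A \<and> Ran B a \<in> A \<and> Inv B a \<in> A) \<and>
     (\<forall>a \<in> A. \<forall>b \<in> A. Ran B a = Dom B b \<longrightarrow> a \<cdot>\<^bsub>B\<^esub> b \<in> A)"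

definition enlargement :: "'a set \<Rightarrow> 'a ogpd \<Rightarrow> bool" where
  "enlargement A B \<longleftrightarrow>
     ordered_groupoid B \<and> subgroupoid A B \<and>
     (\<forall>e \<in> A \<inter> Idents B. \<forall>f \<in> Idents B. f \<preceq>\<^bsub>B\<^esub> e \<longrightarrow> f \<in> A) \<and>
     (\<forall>b \<in> Arr B. Dom B b \<in> A \<and> Ran B b \<in> A \<longrightarrow> b \<in> A) \<and>
     (\<forall>e \<in> Idents B. \<exists>b \<in> Arr B. Dom B b = e \<and> Ran B b \<in> A \<inter> Idents B)"

definition ordered_embedding :: "'a ogpd \<Rightarrow> 'b ogpd \<Rightarrow> ('a \<Rightarrow> 'b) \<Rightarrow> bool" where
  "ordered_embedding U B i \<longleftrightarrow>
     ordered_functor U B i \<and> inj_on i (Arr U) \<and>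
     (\<forall>u \<in> Arr U. \<forall>v \<in> Arr U. i u \<preceq>\<^bsub>B\<^esub> i v \<longrightarrow> u \<preceq>\<^bsub>U\<^esub> v)"

definition enlargement_map :: "'a ogpd \<Rightarrow> 'b ogpd \<Rightarrow> ('a \<Rightarrow> 'b) \<Rightarrow> bool" where
  "enlargement_map U B i \<longleftrightarrow> ordered_embedding U B i \<and> enlargement (i ` Arr U) B"

section \<open>The quotient \<open>G//A\<close>\<close>

text \<open>\<open>below_mod G A g k\<close> says that \<open>agb\<close> is defined and \<open>agb \<preceq> k\<close> for some \<open>a, b \<in> A\<close>.\<close>

definition below_mod :: "'a ogpd \<Rightarrow> 'a set \<Rightarrow> 'a \<Rightarrow> 'a \<Rightarrow> bool" where
  "below_mod G A g k \<longleftrightarrow>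
     (\<exists>a \<in> A. \<exists>b \<in> A. Ran G a = Dom G g \<and> Ran G g = Dom G b \<and> a \<cdot>\<^bsub>G\<^esub> g \<cdot>\<^bsub>G\<^esub> b \<preceq>\<^bsub>G\<^esub> k)"

definition equiv_mod :: "'a ogpd \<Rightarrow> 'a set \<Rightarrow> 'a \<Rightarrow> 'a \<Rightarrow> bool" where
  "equiv_mod G A g h \<longleftrightarrow> below_mod G A g h \<and> below_mod G A h g"

definition qclass :: "'a ogpd \<Rightarrow> 'a set \<Rightarrow> 'a \<Rightarrow> 'a set" where
  "qclass G A g = {h \<in> Arr G. equiv_mod G A g h}"

definition nexus :: "'a ogpd \<Rightarrow> 'a set \<Rightarrow> 'a \<Rightarrow> 'a \<Rightarrow> 'a \<Rightarrow> 'a \<Rightarrow> bool" where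
  "nexus G A e f a p \<longleftrightarrow>
     a \<in> A \<and> p \<in> A \<and>
     Dom G a \<preceq>\<^bsub>G\<^esub> e \<and> Ran G a = f \<and> Dom G p \<preceq>\<^bsub>G\<^esub> f \<and> Ran G p = e"

text \<open>
  The class operations are given on representatives and a nexus; the description operator
  picks the common value of all such choices. In particular \<open>[g]\<close> and \<open>[h]\<close> are composable
  iff \<open>[Ran g] = [Dom h]\<close>.
\<close>

definition quot :: "'a ogpd \<Rightarrow> 'a set \<Rightarrow> 'a set ogpd" where
  "quot G A = \<lparr>
     Arr = qclass G A ` Arr G,
     Dom = (\<lambda>X. THE Z. \<exists>g \<in> X. Z = qclass G A (Dom G g)),
     Ran = (\<lambda>X. THE Z. \<exists>g \<in> X. Z = qclass G A (Ran G g)),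
     Comp = (\<lambda>X Y. THE Z. \<exists>g \<in> X. \<exists>h \<in> Y. \<exists>a p. nexus G A (Ran G g) (Dom G h) a p \<and>
               Z = qclass G A (corestr G g (Dom G a) \<cdot>\<^bsub>G\<^esub> a \<cdot>\<^bsub>G\<^esub> h)),
     Leq = (\<lambda>X Y. \<exists>g \<in> X. \<exists>k \<in> Y. below_mod G A g k) \<rparr>"

definition induced :: "('a \<Rightarrow> 'b) \<Rightarrow> 'a set \<Rightarrow> 'b" where
  "induced \<phi> X = (THE h. \<exists>g \<in> X. h = \<phi> g)"

section \<open>The ordered groupoid \<open>H \<ltimes> (U\<^sub>0 \<otimes> \<Omega>H)\<close>\<close>

definition box :: "'u ogpd \<Rightarrow> 'b ogpd \<Rightarrow> ('u \<Rightarrow> 'b) \<Rightarrow> ('u \<times> 'b) set" where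
  "box U H \<psi> = {(e, h). e \<in> Idents U \<and> h \<in> Arr H \<and> \<psi> e = Dom H h}"

text \<open>\<open>tens U H \<psi> e h\<close> is the class \<open>e \<otimes> h\<close>.\<close>

definition tens :: "'u ogpd \<Rightarrow> 'b ogpd \<Rightarrow> ('u \<Rightarrow> 'b) \<Rightarrow> 'u \<Rightarrow> 'b \<Rightarrow> ('u \<times> 'b) set" where
  "tens U H \<psi> e h = {(f, k) \<in> box U H \<psi>.
     \<exists>u \<in> Arr U. Dom U u = e \<and> Ran U u = f \<and> h = \<psi> u \<cdot>\<^bsub>H\<^esub> k}"

definition tens_le :: "'u ogpd \<Rightarrow> 'b ogpd \<Rightarrow> ('u \<times> 'b) set \<Rightarrow> ('u \<times> 'b) set \<Rightarrow> bool" where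
  "tens_le U H X Y \<longleftrightarrow> (\<exists>(x, l) \<in> X. \<exists>(e, k) \<in> Y. x \<preceq>\<^bsub>U\<^esub> e \<and> l \<preceq>\<^bsub>H\<^esub> k)"

definition tens_act ::
  "'u ogpd \<Rightarrow> 'b ogpd \<Rightarrow> ('u \<Rightarrow> 'b) \<Rightarrow> ('u \<times> 'b) set \<Rightarrow> 'b \<Rightarrow> ('u \<times> 'b) set" where
  "tens_act U H \<psi> X m = (THE Y. \<exists>(e, h) \<in> X. Y = tens U H \<psi> e (h \<cdot>\<^bsub>H\<^esub> m))"

text \<open>The object \<open>e \<otimes> h\<close> is identified with the identity arrow \<open>(Ran h, e \<otimes> h)\<close>.\<close>

definition Htilde :: "'u ogpd \<Rightarrow> 'b ogpd \<Rightarrow> ('u \<Rightarrow> 'b) \<Rightarrow> ('b \<times> ('u \<times> 'b) set) ogpd" where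
  "Htilde U H \<psi> = \<lparr>
     Arr = {(k, tens U H \<psi> e h) | k e h.
              k \<in> Arr H \<and> (e, h) \<in> box U H \<psi> \<and> Ran H k = Ran H h},
     Dom = (\<lambda>(k, X). (Dom H k, tens_act U H \<psi> X (Inv H k))),
     Ran = (\<lambda>(k, X). (Ran H k, X)),
     Comp = (\<lambda>(k, X) (m, Y). (k \<cdot>\<^bsub>H\<^esub> m, Y)),
     Leq = (\<lambda>(k, X) (m, Y). k \<preceq>\<^bsub>H\<^esub> m \<and> tens_le U H X Y) \<rparr>"

definition incl :: "'u ogpd \<Rightarrow> 'b ogpd \<Rightarrow> ('u \<Rightarrow> 'b) \<Rightarrow> 'u \<Rightarrow> 'b \<times> ('u \<times> 'b) set" where
  "incl U H \<psi> u = (\<psi> u, tens U H \<psi> (Dom U u) (\<psi> u))"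

end

theory Submission
  imports Defs
begin

text \<open>
  The whole argument rests on one rigidity principle, the uniqueness in the restriction
  axiom: two arrows below a common arrow coincide as soon as their domains (or their
  ranges) do.

  Let \<open>A\<close> be the kernel of \<open>\<phi>\<close>. Multiplying by kernel arrows does not change the image under
  \<open>\<phi>\<close>. Conversely, if the domain of \<open>g\<close> can be moved below that of \<open>k\<close> by a kernel arrow \<open>a\<close>
  and \<open>\<phi> g \<preceq> \<phi> k\<close>, then \<open>ag\<close> and the restriction \<open>k'\<close> of \<open>k\<close> to \<open>Dom a\<close> have the same
  image by rigidity in \<open>H\<close>, so \<open>(ag)\<^sup>-\<^sup>1k'\<close> is a kernel arrow. Hence the relation that defines
  the quotient is seen on the objects and in \<open>H\<close> alone (\<open>below_mod_iff\<close>), and the class of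
  \<open>g\<close> amounts to the pair formed by the class of \<open>Dom g\<close> and the arrow \<open>\<phi> g\<close>. Star-injectivity
  of the induced functor \<open>\<psi>\<close> is then immediate, and associativity and most of the order axioms are
  inherited from \<open>H\<close>. The composition calls for work with representatives: a nexus
  replaces two arrows with equivalent ends by equivalent arrows that are composable in \<open>G\<close>
  (\<open>composable_representatives\<close>).

  For the second half let \<open>\<psi> : U \<rightarrow> H\<close> be star-injective. A class \<open>e \<otimes> h\<close> is the end point of a
  formal lift of \<open>h\<close> that starts at \<open>e\<close>. If \<open>h = \<psi> u\<close> for an arrow \<open>u\<close> that starts at \<open>e\<close>, this
  end point is the object \<open>Ran u\<close>, that is, \<open>Ran u \<otimes> \<psi> (Ran u)\<close> (\<open>tens_map\<close>). Right
  multiplication by \<open>H\<close> moves end points along arrows of \<open>H\<close>, and an arrow of the resulting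
  action groupoid is given freely by its domain and its \<open>H\<close>-component, so the projection to \<open>H\<close> is a
  covering. An object \<open>e\<close> of \<open>U\<close> becomes \<open>e \<otimes> \<psi> e\<close>. Star-injectivity ensures that
  nothing is identified: the order of end points is antisymmetric (\<open>tens_le_antisym\<close>), and
  \<open>U\<close> is embedded with its order (\<open>incl_Leq\<close>). An arrow from \<open>e \<otimes> \<psi> e\<close> to \<open>f \<otimes> \<psi> f\<close>
  comes from \<open>U\<close> because an equality of classes is, by definition, witnessed by an arrow of
  \<open>U\<close> (\<open>incl_full\<close>). Finally every end point \<open>e \<otimes> h\<close> is joined to \<open>e \<otimes> \<psi> e\<close> by
  \<open>h\<^sup>-\<^sup>1\<close>. Together these say that \<open>U\<close> is included as an enlargement.
\<close>

section \<open>Groupoids\<close>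

context groupoid
begin

lemmas groupoid_simps =
  Dom_closed Ran_closed Dom_Dom Ran_Dom Dom_Ran Ran_Ran Comp_closed Dom_Comp Ran_Comp
  Comp_Dom Comp_Ran Comp_assoc

lemma is_inverse_unique:
  assumes "g \<in> Arr G" "is_inverse G g h" "is_inverse G g k"
  shows "h = k"
proof -
  have "h = h \<cdot> (g \<cdot> k)"
    using assms by (metis Comp_Ran is_inverse_def)
  also have "\<dots> = (h \<cdot> g) \<cdot> k"
    using assms by (intro Comp_assoc[symmetric]) (simp_all add: is_inverse_def)
  also have "\<dots> = k"
    using assms by (metis Comp_Dom is_inverse_def)
  finally show ?thesis .
qed

lemma Inv_eqI: "\<lbrakk>g \<in> Arr G; is_inverse G g h\<rbrakk> \<Longrightarrow> Inv G g = h"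
  unfolding Inv_def by (rule the_equality) (auto intro: is_inverse_unique)

lemma is_inverse_Inv: "g \<in> Arr G \<Longrightarrow> is_inverse G g (Inv G g)"
  using inverse_exists Inv_eqI by metis

lemma Inv_closed: "g \<in> Arr G \<Longrightarrow> Inv G g \<in> Arr G"
  and Dom_Inv: "g \<in> Arr G \<Longrightarrow> Dom G (Inv G g) = Ran G g"
  and Ran_Inv: "g \<in> Arr G \<Longrightarrow> Ran G (Inv G g) = Dom G g"
  and Comp_Inv: "g \<in> Arr G \<Longrightarrow> g \<cdot> Inv G g = Dom G g"
  and Inv_Comp: "g \<in> Arr G \<Longrightarrow> Inv G g \<cdot> g = Ran G g"
  using is_inverse_Inv by (auto simp: is_inverse_def)

lemma Inv_Inv: "g \<in> Arr G \<Longrightarrow> Inv G (Inv G g) = g"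
  by (rule Inv_eqI) (simp_all add: is_inverse_def Inv_closed Dom_Inv Ran_Inv Comp_Inv Inv_Comp)

lemmas inverse_simps = Inv_closed Dom_Inv Ran_Inv Comp_Inv Inv_Comp Inv_Inv

lemma Comp_Inv_cancel: "\<lbrakk>g \<in> Arr G; h \<in> Arr G; Dom G g = Dom G h\<rbrakk> \<Longrightarrow> g \<cdot> (Inv G g \<cdot> h) = h"
  by (simp add: inverse_simps groupoid_simps Comp_assoc[symmetric])

lemma Inv_Comp_cancel: "\<lbrakk>g \<in> Arr G; h \<in> Arr G; Ran G g = Dom G h\<rbrakk> \<Longrightarrow> Inv G g \<cdot> (g \<cdot> h) = h"
  by (simp add: inverse_simps groupoid_simps Comp_assoc[symmetric])

lemmas cancel_simps = Comp_Inv_cancel Inv_Comp_cancel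

lemma Inv_of_Comp:
  assumes "g \<in> Arr G" "h \<in> Arr G" "Ran G g = Dom G h"
  shows "Inv G (g \<cdot> h) = Inv G h \<cdot> Inv G g"
  by (rule Inv_eqI)
    (use assms in \<open>simp_all add: is_inverse_def inverse_simps groupoid_simps cancel_simps\<close>)

lemma Ident_closed: "e \<in> Idents G \<Longrightarrow> e \<in> Arr G"
  and Dom_Ident: "e \<in> Idents G \<Longrightarrow> Dom G e = e"
  and Ran_Ident: "e \<in> Idents G \<Longrightarrow> Ran G e = e"
  unfolding Idents_def using Ran_Dom by force+

lemma Dom_in_Idents: "g \<in> Arr G \<Longrightarrow> Dom G g \<in> Idents G"
  and Ran_in_Idents: "g \<in> Arr G \<Longrightarrow> Ran G g \<in> Idents G"
  by (simp_all add: Idents_def groupoid_simps)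

lemma Inv_Ident: "e \<in> Idents G \<Longrightarrow> Inv G e = e"
  by (metis Comp_Ran Comp_Inv Dom_Ident Ident_closed Inv_closed Inv_Comp Dom_Inv Comp_Dom Ran_Ident Ran_Inv)

lemma Ident_Comp: "\<lbrakk>e \<in> Idents G; g \<in> Arr G; e = Dom G g\<rbrakk> \<Longrightarrow> e \<cdot> g = g"
  and Comp_Ident: "\<lbrakk>e \<in> Idents G; g \<in> Arr G; Ran G g = e\<rbrakk> \<Longrightarrow> g \<cdot> e = g"
  using Comp_Dom Comp_Ran by auto

lemmas ident_simps = Ident_closed Dom_Ident Ran_Ident Dom_in_Idents Ran_in_Idents Inv_Ident
  Ident_Comp Comp_Ident

lemmas gsimps = groupoid_simps inverse_simps cancel_simps ident_simps

end

section \<open>Ordered groupoids\<close>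

context ordered_groupoid
begin

lemma Dom_mono:
  assumes "g \<in> Arr G" "h \<in> Arr G" "g \<preceq> h"
  shows "Dom G g \<preceq> Dom G h"
  using OG2[of g h "Inv G g" "Inv G h"] OG1[of g h] assms by (simp add: gsimps)

lemma Ran_mono: "\<lbrakk>g \<in> Arr G; h \<in> Arr G; g \<preceq> h\<rbrakk> \<Longrightarrow> Ran G g \<preceq> Ran G h"
  using Dom_mono[of "Inv G g" "Inv G h"] OG1[of g h] by (simp add: gsimps)

lemma eq_if_le_and_Dom_eq:
  assumes "g \<in> Arr G" "h \<in> Arr G" "k \<in> Arr G" "g \<preceq> k" "h \<preceq> k" "Dom G g = Dom G h"
  shows "g = h"
  using OG3[of k "Dom G g"] assms Dom_mono[of g k] Dom_in_Idents[of g] by metis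

lemma eq_if_le_and_Ran_eq:
  assumes "g \<in> Arr G" "h \<in> Arr G" "k \<in> Arr G" "g \<preceq> k" "h \<preceq> k" "Ran G g = Ran G h"
  shows "g = h"
proof -
  have "Inv G g = Inv G h"
    by (rule eq_if_le_and_Dom_eq[of _ _ "Inv G k"]) (use assms in \<open>simp_all add: gsimps OG1\<close>)
  then show ?thesis using assms Inv_Inv by metis
qed

text \<open>
  The arrows \<open>g\<close> and \<open>Dom g\<close> both lie below \<open>e\<close> and have the same domain.
\<close>

lemma below_Ident:
  assumes "g \<in> Arr G" "e \<in> Idents G" "g \<preceq> e"
  shows "g \<in> Idents G"
proof -
  have "Dom G g = g"
    by (rule eq_if_le_and_Dom_eq[of _ _ e])
      (use assms Dom_mono[of g e] in \<open>simp_all add: gsimps\<close>)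
  then show ?thesis using assms by (simp add: Idents_def)
qed

lemma restr_props:
  assumes "g \<in> Arr G" "f \<in> Idents G" "f \<preceq> Dom G g"
  shows restr_closed: "restr G f g \<in> Arr G"
    and restr_le: "restr G f g \<preceq> g"
    and Dom_restr: "Dom G (restr G f g) = f"
  using theI'[OF OG3[OF assms]] by (simp_all add: restr_def)

lemma corestr_props:
  assumes "g \<in> Arr G" "f \<in> Idents G" "f \<preceq> Ran G g"
  shows corestr_closed: "corestr G g f \<in> Arr G"
    and corestr_le: "corestr G g f \<preceq> g"
    and Ran_corestr: "Ran G (corestr G g f) = f"
  using restr_props[of "Inv G g" f] OG1[of "restr G f (Inv G g)" "Inv G g"] assms
  by (simp_all add: corestr_def gsimps)

lemmas restr_simps = restr_closed restr_le Dom_restr corestr_closed corestr_le Ran_corestr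

end

section \<open>Ordered functors\<close>

context ordered_functor
begin

lemma map_Idents: "e \<in> Idents G \<Longrightarrow> \<phi> e \<in> Idents H"
  using map_closed map_Dom by (fastforce simp: Idents_def)

lemma map_Inv: "g \<in> Arr G \<Longrightarrow> \<phi> (Inv G g) = Inv H (\<phi> g)"
  by (rule H.Inv_eqI[symmetric])
    (simp_all add: is_inverse_def G.gsimps map_closed map_Comp[symmetric]
      flip: map_Dom map_Ran)

lemmas map_simps = map_closed map_Dom map_Ran map_Comp map_Idents map_Inv

end

section \<open>The quotient by the kernel\<close>

context ordered_functor
begin

abbreviation K :: "'a set" where "K \<equiv> kernel G H \<phi>"
abbreviation cls :: "'a \<Rightarrow> 'a set" where "cls \<equiv> qclass G K"
abbreviation Q :: "'a set ogpd" where "Q \<equiv> quot G K"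

text \<open>
  The preorder on objects that underlies \<open>below_mod\<close>. If \<open>aeb\<close> lies below an identity, then
  it is itself an identity and \<open>b\<close> is the inverse of \<open>a\<close>; hence a single kernel arrow is enough.
\<close>

definition obj_below :: "'a \<Rightarrow> 'a \<Rightarrow> bool" where
  "obj_below e f \<longleftrightarrow> (\<exists>a \<in> K. Ran G a = e \<and> Dom G a \<preceq>\<^bsub>G\<^esub> f)"

lemma kernel_closed: "a \<in> K \<Longrightarrow> a \<in> Arr G"
  by (simp add: kernel_def)

lemma map_kernel:
  assumes "a \<in> K"
  shows "\<phi> a \<in> Idents H" "Dom H (\<phi> a) = \<phi> a" "Ran H (\<phi> a) = \<phi> a"
  using assms by (simp_all add: kernel_def H.gsimps)

lemma Ident_in_kernel: "e \<in> Idents G \<Longrightarrow> e \<in> K"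
  by (simp add: kernel_def map_simps G.gsimps)

lemma Inv_in_kernel: "a \<in> K \<Longrightarrow> Inv G a \<in> K"
  by (simp add: kernel_def map_simps H.gsimps G.gsimps)

lemma Comp_in_kernel: "\<lbrakk>a \<in> K; b \<in> K; Ran G a = Dom G b\<rbrakk> \<Longrightarrow> a \<cdot>\<^bsub>G\<^esub> b \<in> K"
  using map_kernel[of a] map_kernel[of b] map_Ran[of a] map_Dom[of b]
  by (simp add: kernel_def map_simps H.gsimps G.gsimps)

lemma kernel_downward: "\<lbrakk>g \<in> Arr G; a \<in> K; g \<preceq>\<^bsub>G\<^esub> a\<rbrakk> \<Longrightarrow> g \<in> K"
  using H.below_Ident[of "\<phi> g" "\<phi> a"] map_Leq[of g a] by (simp add: kernel_def map_simps)

lemma map_Dom_kernel: "a \<in> K \<Longrightarrow> \<phi> (Dom G a) = \<phi> a"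
  and map_Ran_kernel: "a \<in> K \<Longrightarrow> \<phi> (Ran G a) = \<phi> a"
  by (simp_all add: map_kernel map_Dom map_Ran kernel_closed)

text \<open>
  Restricting an arrow in \<open>G\<close> is invisible in \<open>H\<close> if the image of one end is unchanged, by
  uniqueness of restrictions in \<open>H\<close>.
\<close>

lemma map_eq_if_le:
  assumes "g \<in> Arr G" "k \<in> Arr G" "g \<preceq>\<^bsub>G\<^esub> k"
    and "\<phi> (Dom G g) = \<phi> (Dom G k) \<or> \<phi> (Ran G g) = \<phi> (Ran G k)"
  shows "\<phi> g = \<phi> k"
  using H.eq_if_le_and_Dom_eq[of "\<phi> g" "\<phi> k" "\<phi> k"] H.eq_if_le_and_Ran_eq[of "\<phi> g" "\<phi> k" "\<phi> k"]
    map_Leq assms by (auto simp: map_simps H.Leq_refl)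

lemma obj_below_refl: "e \<in> Idents G \<Longrightarrow> obj_below e e"
  unfolding obj_below_def
  by (intro bexI[of _ e]) (simp_all add: Ident_in_kernel G.gsimps G.Leq_refl)

lemma obj_below_if_le:
  assumes "e \<in> Idents G" "e \<preceq>\<^bsub>G\<^esub> f"
  shows "obj_below e f"
  unfolding obj_below_def
  by (intro bexI[of _ e]) (use assms in \<open>simp_all add: Ident_in_kernel G.gsimps\<close>)

lemma obj_below_kernel:
  assumes "a \<in> K"
  shows "obj_below (Dom G a) (Ran G a)" "obj_below (Ran G a) (Dom G a)"
proof -
  show "obj_below (Dom G a) (Ran G a)"
    unfolding obj_below_def
    by (intro bexI[of _ "Inv G a"])
      (use assms kernel_closed in \<open>simp_all add: Inv_in_kernel G.gsimps G.Leq_refl\<close>)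
  show "obj_below (Ran G a) (Dom G a)"
    unfolding obj_below_def
    by (intro bexI[of _ a]) (use assms kernel_closed in \<open>simp_all add: G.gsimps G.Leq_refl\<close>)
qed

text \<open>
  The second kernel arrow is cut down so that it ends where the first one begins; it stays in
  the kernel because only identities lie below an identity of \<open>H\<close>.
\<close>

lemma obj_below_trans:
  assumes "f \<in> Idents G" "k \<in> Idents G" "obj_below e f" "obj_below f k"
  shows "obj_below e k"
proof -
  obtain a b where a: "a \<in> K" "Ran G a = e" "Dom G a \<preceq>\<^bsub>G\<^esub> f"
    and b: "b \<in> K" "Ran G b = f" "Dom G b \<preceq>\<^bsub>G\<^esub> k"
    using assms by (auto simp: obj_below_def)
  note ab = a(1)[THEN kernel_closed] b(1)[THEN kernel_closed]
  let ?c = "corestr G b (Dom G a)"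
  have c: "?c \<in> Arr G" "?c \<preceq>\<^bsub>G\<^esub> b" "Ran G ?c = Dom G a"
    using a b ab by (simp_all add: G.restr_simps G.gsimps)
  then have "?c \<in> K" using b kernel_downward by blast
  moreover have "Dom G ?c \<preceq>\<^bsub>G\<^esub> k"
    using G.Leq_trans[OF _ _ _ G.Dom_mono[of ?c b] b(3)] ab c assms by (simp add: G.gsimps)
  ultimately show ?thesis
    unfolding obj_below_def using a c ab
    by (intro bexI[of _ "?c \<cdot>\<^bsub>G\<^esub> a"]) (simp_all add: Comp_in_kernel G.gsimps)
qed

lemma obj_below_map:
  assumes "f \<in> Idents G" "obj_below e f"
  shows "\<phi> e \<preceq>\<^bsub>H\<^esub> \<phi> f"
proof -
  obtain a where a: "a \<in> K" "Ran G a = e" "Dom G a \<preceq>\<^bsub>G\<^esub> f"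
    using assms by (auto simp: obj_below_def)
  then have "\<phi> e = \<phi> (Dom G a)" by (metis map_Dom_kernel map_Ran_kernel)
  then show ?thesis using a assms kernel_closed by (simp add: map_Leq G.gsimps)
qed

text \<open>
  The second kernel arrow \<open>b\<close> has disappeared from the right-hand side: it is forced to be
  \<open>(ag)\<^sup>-\<^sup>1k'\<close>, where \<open>k'\<close> is the restriction of \<open>k\<close> to \<open>Dom a\<close>. It lies in the kernel
  because \<open>\<phi> g\<close> and \<open>\<phi> k'\<close> both lie below \<open>\<phi> k\<close> and start at the same identity.
\<close>

lemma below_mod_iff:
  assumes g: "g \<in> Arr G" and k: "k \<in> Arr G"
  shows "below_mod G K g k \<longleftrightarrow> obj_below (Dom G g) (Dom G k) \<and> \<phi> g \<preceq>\<^bsub>H\<^esub> \<phi> k"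
proof
  assume "below_mod G K g k"
  then obtain a b where ab: "a \<in> K" "b \<in> K" "Ran G a = Dom G g" "Ran G g = Dom G b"
    and le: "a \<cdot>\<^bsub>G\<^esub> g \<cdot>\<^bsub>G\<^esub> b \<preceq>\<^bsub>G\<^esub> k"
    by (auto simp: below_mod_def)
  note arr = ab(1)[THEN kernel_closed] ab(2)[THEN kernel_closed] g k
  have "\<phi> a = Dom H (\<phi> g)" "\<phi> b = Ran H (\<phi> g)"
    using ab arr by (metis map_Ran_kernel map_Dom, metis map_Dom_kernel map_Ran)
  then have "\<phi> (a \<cdot>\<^bsub>G\<^esub> g \<cdot>\<^bsub>G\<^esub> b) = \<phi> g"
    using ab arr by (simp add: map_simps G.gsimps H.gsimps)
  then have "\<phi> g \<preceq>\<^bsub>H\<^esub> \<phi> k"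
    using map_Leq[OF _ _ le] ab arr by (simp add: G.gsimps)
  moreover have "Dom G a \<preceq>\<^bsub>G\<^esub> Dom G k"
    using G.Dom_mono[OF _ _ le] ab arr by (simp add: G.gsimps)
  ultimately show "obj_below (Dom G g) (Dom G k) \<and> \<phi> g \<preceq>\<^bsub>H\<^esub> \<phi> k"
    using ab by (auto simp: obj_below_def)
next
  assume "obj_below (Dom G g) (Dom G k) \<and> \<phi> g \<preceq>\<^bsub>H\<^esub> \<phi> k"
  then obtain a where a: "a \<in> K" "Ran G a = Dom G g" "Dom G a \<preceq>\<^bsub>G\<^esub> Dom G k"
    and le: "\<phi> g \<preceq>\<^bsub>H\<^esub> \<phi> k"
    by (auto simp: obj_below_def)
  note arr = a(1)[THEN kernel_closed] g k
  let ?k = "restr G (Dom G a) k"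
  have k': "?k \<in> Arr G" "?k \<preceq>\<^bsub>G\<^esub> k" "Dom G ?k = Dom G a"
    using a arr by (simp_all add: G.restr_simps G.gsimps)
  have \<phi>a: "\<phi> a = Dom H (\<phi> g)" using a arr by (metis map_Ran_kernel map_Dom)
  have "\<phi> ?k = \<phi> g"
    by (rule H.eq_if_le_and_Dom_eq[of _ _ "\<phi> k"])
      (use k' arr le \<phi>a a in \<open>simp_all add: map_simps map_Leq map_kernel flip: map_Dom\<close>,
       metis map_Dom_kernel map_Dom)
  let ?b = "Inv G (a \<cdot>\<^bsub>G\<^esub> g) \<cdot>\<^bsub>G\<^esub> ?k"
  have "\<phi> ?b = Ran H (\<phi> g)"
    using \<open>\<phi> ?k = \<phi> g\<close> \<phi>a arr a k' by (simp add: map_simps G.gsimps H.gsimps)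
  then have "?b \<in> K" using a k' arr by (simp add: kernel_def map_simps G.gsimps H.gsimps)
  moreover have "a \<cdot>\<^bsub>G\<^esub> g \<cdot>\<^bsub>G\<^esub> ?b = ?k"
    using a k' arr by (simp add: G.gsimps del: G.Comp_assoc)
  ultimately show "below_mod G K g k"
    unfolding below_mod_def using a k' arr
    by (intro bexI[of _ a] bexI[of _ ?b]) (simp_all add: G.gsimps)
qed

definition obj_equiv :: "'a \<Rightarrow> 'a \<Rightarrow> bool" where
  "obj_equiv e f \<longleftrightarrow> obj_below e f \<and> obj_below f e"

lemma equiv_mod_iff:
  "\<lbrakk>g \<in> Arr G; h \<in> Arr G\<rbrakk> \<Longrightarrow>
    equiv_mod G K g h \<longleftrightarrow> obj_equiv (Dom G g) (Dom G h) \<and> \<phi> g = \<phi> h"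
  using H.Leq_antisym[of "\<phi> g" "\<phi> h"] H.Leq_refl[of "\<phi> h"]
  by (auto simp: equiv_mod_def below_mod_iff map_closed obj_equiv_def)

lemma obj_equiv_refl: "e \<in> Idents G \<Longrightarrow> obj_equiv e e"
  and obj_equiv_sym: "obj_equiv e f \<Longrightarrow> obj_equiv f e"
  and obj_equiv_trans: "\<lbrakk>e \<in> Idents G; f \<in> Idents G; k \<in> Idents G; obj_equiv e f; obj_equiv f k\<rbrakk>
    \<Longrightarrow> obj_equiv e k"
  unfolding obj_equiv_def by (blast intro: obj_below_refl obj_below_trans)+

lemma obj_equiv_map: "\<lbrakk>e \<in> Idents G; f \<in> Idents G; obj_equiv e f\<rbrakk> \<Longrightarrow> \<phi> e = \<phi> f"
  using obj_below_map[of e f] obj_below_map[of f e] H.Leq_antisym[of "\<phi> e" "\<phi> f"]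
  by (simp add: obj_equiv_def map_simps G.gsimps)

lemma obj_equiv_kernel: "a \<in> K \<Longrightarrow> obj_equiv (Dom G a) (Ran G a)"
  by (simp add: obj_equiv_def obj_below_kernel)

lemma cls_eq_iff:
  assumes "g \<in> Arr G" "h \<in> Arr G"
  shows "cls g = cls h \<longleftrightarrow> obj_equiv (Dom G g) (Dom G h) \<and> \<phi> g = \<phi> h"
proof
  assume "cls g = cls h"
  moreover have "h \<in> cls h"
    using assms by (simp add: qclass_def equiv_mod_iff obj_equiv_refl G.gsimps)
  ultimately have "h \<in> cls g" by simp
  then show "obj_equiv (Dom G g) (Dom G h) \<and> \<phi> g = \<phi> h"
    using assms by (simp add: qclass_def equiv_mod_iff)
next
  assume *: "obj_equiv (Dom G g) (Dom G h) \<and> \<phi> g = \<phi> h"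
  have "obj_equiv (Dom G g) (Dom G x) \<longleftrightarrow> obj_equiv (Dom G h) (Dom G x)" if "x \<in> Arr G" for x
    using * assms that obj_equiv_sym[of "Dom G g" "Dom G h"]
      obj_equiv_trans[of "Dom G g" "Dom G h" "Dom G x"]
      obj_equiv_trans[of "Dom G h" "Dom G g" "Dom G x"] by (auto simp: G.Dom_in_Idents)
  then show "cls g = cls h"
    using assms * by (auto simp: qclass_def equiv_mod_iff)
qed

lemma mem_cls_iff: "g \<in> Arr G \<Longrightarrow> h \<in> cls g \<longleftrightarrow> h \<in> Arr G \<and> cls h = cls g"
proof -
  assume g: "g \<in> Arr G"
  have "h \<in> cls g \<longleftrightarrow> h \<in> Arr G \<and> equiv_mod G K g h"
    by (simp add: qclass_def)
  then show ?thesis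
    using g equiv_mod_iff[of g h] cls_eq_iff[of g h] by auto
qed

lemma cls_self: "g \<in> Arr G \<Longrightarrow> g \<in> cls g"
  by (simp add: mem_cls_iff)

lemma cls_Ident_iff: "\<lbrakk>e \<in> Idents G; f \<in> Idents G\<rbrakk> \<Longrightarrow> cls e = cls f \<longleftrightarrow> obj_equiv e f"
  using obj_equiv_map[of e f] by (auto simp: cls_eq_iff G.gsimps)

text \<open>
  Inverting \<open>agb \<preceq> k\<close> exchanges the two kernel arrows. Through this symmetry statements about
  domains carry over to ranges.
\<close>

lemma below_mod_Inv:
  assumes g: "g \<in> Arr G" and k: "k \<in> Arr G" and b: "below_mod G K g k"
  shows "below_mod G K (Inv G g) (Inv G k)"
proof -
  obtain a b where ab: "a \<in> K" "b \<in> K" "Ran G a = Dom G g" "Ran G g = Dom G b"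
    and le: "a \<cdot>\<^bsub>G\<^esub> g \<cdot>\<^bsub>G\<^esub> b \<preceq>\<^bsub>G\<^esub> k"
    using b by (auto simp: below_mod_def)
  note arr = ab(1)[THEN kernel_closed] ab(2)[THEN kernel_closed] g k
  have "Inv G b \<cdot>\<^bsub>G\<^esub> Inv G g \<cdot>\<^bsub>G\<^esub> Inv G a \<preceq>\<^bsub>G\<^esub> Inv G k"
    using G.OG1[OF _ _ le] ab arr by (simp add: G.gsimps G.Inv_of_Comp)
  then show ?thesis
    unfolding below_mod_def using ab arr
    by (intro bexI[of _ "Inv G b"] bexI[of _ "Inv G a"]) (simp_all add: G.gsimps Inv_in_kernel)
qed

lemma below_mod_Ran:
  assumes "g \<in> Arr G" "k \<in> Arr G" "below_mod G K g k"
  shows "obj_below (Ran G g) (Ran G k)"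
  using below_mod_Inv[OF assms] assms by (simp add: below_mod_iff G.gsimps)

lemma cls_eq_Dom: "\<lbrakk>g \<in> Arr G; h \<in> Arr G; cls g = cls h\<rbrakk> \<Longrightarrow> cls (Dom G g) = cls (Dom G h)"
  by (simp add: cls_eq_iff cls_Ident_iff G.gsimps map_simps)

lemma cls_eq_Ran: "\<lbrakk>g \<in> Arr G; h \<in> Arr G; cls g = cls h\<rbrakk> \<Longrightarrow> cls (Ran G g) = cls (Ran G h)"
  using below_mod_Ran[of g h] below_mod_Ran[of h g] equiv_mod_iff[of g h]
  by (simp add: cls_eq_iff[of g h] equiv_mod_def cls_Ident_iff G.Ran_in_Idents obj_equiv_def)

lemma cls_eq_map: "\<lbrakk>g \<in> Arr G; h \<in> Arr G; cls g = cls h\<rbrakk> \<Longrightarrow> \<phi> g = \<phi> h"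
  by (simp add: cls_eq_iff)

lemma nexus_exists:
  assumes "e \<in> Idents G" "f \<in> Idents G" "cls e = cls f"
  obtains a p where "nexus G K e f a p"
  using assms by (auto simp: cls_Ident_iff obj_equiv_def obj_below_def nexus_def)

text \<open>
  Cutting \<open>g\<close> down to the part of its range that the nexus reaches does not change its class.
  At the range this holds because \<open>Dom a\<close>, \<open>Dom h\<close> and \<open>Ran g\<close> are equivalent objects; the domain
  is reached by comparing the inverses of the two arrows.
\<close>

lemma corestr_nexus:
  assumes g: "g \<in> Arr G" and h: "h \<in> Arr G" and n: "nexus G K (Ran G g) (Dom G h) a p"
  defines "g' \<equiv> corestr G g (Dom G a)"
  shows "g' \<in> Arr G" "Ran G g' = Dom G a" "cls g' = cls g"
proof -
  have a: "a \<in> K" "Dom G a \<preceq>\<^bsub>G\<^esub> Ran G g" "Ran G a = Dom G h"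
    and p: "p \<in> K" "Dom G p \<preceq>\<^bsub>G\<^esub> Dom G h" "Ran G p = Ran G g"
    using n by (auto simp: nexus_def)
  note arr = a(1)[THEN kernel_closed] p(1)[THEN kernel_closed] g h
  show g': "g' \<in> Arr G" "Ran G g' = Dom G a"
    unfolding g'_def using a arr by (simp_all add: G.restr_simps G.gsimps)
  have le: "g' \<preceq>\<^bsub>G\<^esub> g"
    unfolding g'_def using a arr by (simp_all add: G.restr_simps G.gsimps)
  have oRan: "obj_equiv (Ran G g) (Dom G h)"
    using a p by (auto simp: obj_equiv_def obj_below_def)
  have "\<phi> (Ran G g') = \<phi> (Ran G g)"
    using obj_equiv_map[OF _ _ oRan] map_Dom_kernel[OF a(1)] map_Ran_kernel[OF a(1)] a(3) g' arr
    by (simp add: G.ident_simps)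
  then have \<phi>: "\<phi> g' = \<phi> g" using map_eq_if_le[OF g'(1) g le] by blast
  have "obj_equiv (Ran G g') (Ran G g)"
    using obj_equiv_trans[OF _ _ _ obj_equiv_kernel[OF a(1)] obj_equiv_sym] oRan a(3) g' arr
    by (simp add: G.ident_simps)
  then have "below_mod G K (Inv G g) (Inv G g')" 
    using arr g' \<phi> by (simp add: below_mod_iff G.gsimps map_simps obj_equiv_def H.Leq_refl H.gsimps)
  then have "obj_below (Dom G g) (Dom G g')"
    using below_mod_Ran[of "Inv G g" "Inv G g'"] arr g' by (simp add: G.gsimps)
  moreover have "obj_below (Dom G g') (Dom G g)"
    using obj_below_if_le G.Dom_mono le arr g' by (simp add: G.gsimps)
  ultimately show "cls g' = cls g"
    using \<phi> arr g' by (simp add: cls_eq_iff obj_equiv_def)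
qed

lemma cls_kernel_Comp:
  assumes "a \<in> K" "h \<in> Arr G" "Ran G a = Dom G h"
  shows "cls (a \<cdot>\<^bsub>G\<^esub> h) = cls h"
proof -
  have "a \<in> Arr G" using assms kernel_closed by blast
  moreover have "\<phi> a = Dom H (\<phi> h)" using assms by (metis map_Ran_kernel map_Dom)
  ultimately show ?thesis using assms obj_equiv_kernel[of a]
    by (simp add: cls_eq_iff G.gsimps map_simps H.gsimps)
qed

text \<open>
  With a nexus \<open>(a, p)\<close> at hand, \<open>g\<close> is cut down to end at \<open>Dom a\<close> and \<open>h\<close> is prolonged to
  \<open>ah\<close>. This reduces composition in the quotient to composition in \<open>G\<close>.
\<close>

lemma composable_representatives:
  assumes "g \<in> Arr G" "h \<in> Arr G" "cls (Ran G g) = cls (Dom G h)"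
  obtains g' h' where "g' \<in> Arr G" "h' \<in> Arr G" "Ran G g' = Dom G h'" "cls g' = cls g" "cls h' = cls h"
proof -
  obtain a p where n: "nexus G K (Ran G g) (Dom G h) a p"
    using nexus_exists[of "Ran G g" "Dom G h"] assms by (auto simp: G.gsimps)
  then have a: "a \<in> K" "a \<in> Arr G" "Ran G a = Dom G h" by (auto simp: nexus_def kernel_closed)
  show thesis
    by (rule that[of "corestr G g (Dom G a)" "a \<cdot>\<^bsub>G\<^esub> h"])
      (use corestr_nexus[OF assms(1,2) n] a assms in \<open>simp_all add: cls_kernel_Comp G.gsimps\<close>)
qed

lemma Arr_Q: "Arr Q = cls ` Arr G"
  by (simp add: quot_def)

lemma cls_in_Arr_Q: "g \<in> Arr G \<Longrightarrow> cls g \<in> Arr Q"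
  by (simp add: Arr_Q)

lemma the_value_on_cls:
  assumes "g \<in> Arr G" "\<And>h. \<lbrakk>h \<in> Arr G; cls h = cls g\<rbrakk> \<Longrightarrow> F h = F g"
  shows "(THE z. \<exists>h \<in> cls g. z = F h) = F g"
proof (rule the_equality)
  show "\<exists>h \<in> cls g. F g = F h" using assms(1) cls_self by blast
next
  fix z assume "\<exists>h \<in> cls g. z = F h"
  then obtain h where "h \<in> cls g" "z = F h" by blast
  then show "z = F g" using assms(2)[of h] by (simp add: mem_cls_iff[OF assms(1)])
qed

lemma Dom_cls: "g \<in> Arr G \<Longrightarrow> Dom Q (cls g) = cls (Dom G g)"
  unfolding quot_def ogpd.simps
  by (rule the_value_on_cls[of g "\<lambda>h. cls (Dom G h)"], assumption, rule cls_eq_Dom, assumption+)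

lemma Ran_cls: "g \<in> Arr G \<Longrightarrow> Ran Q (cls g) = cls (Ran G g)"
  unfolding quot_def ogpd.simps
  by (rule the_value_on_cls[of g "\<lambda>h. cls (Ran G h)"], assumption, rule cls_eq_Ran, assumption+)

lemma map_cls: "g \<in> Arr G \<Longrightarrow> induced \<phi> (cls g) = \<phi> g"
  unfolding induced_def by (rule the_value_on_cls[of g \<phi>], assumption, rule cls_eq_map, assumption+)

lemma cls_of_Comp:
  assumes "g \<in> Arr G" "h \<in> Arr G" "Ran G g = Dom G h"
    and "g' \<in> Arr G" "h' \<in> Arr G" "Ran G g' = Dom G h'" "cls g' = cls g" "cls h' = cls h"
  shows "cls (g' \<cdot>\<^bsub>G\<^esub> h') = cls (g \<cdot>\<^bsub>G\<^esub> h)"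
  using assms by (simp add: cls_eq_iff G.gsimps map_simps)

text \<open>
  Each choice of representatives and of a nexus, as allowed in the definition of the product,
  yields the composite of some composable representatives, and the class of such a composite is
  determined by the domain class and the image of its factors. The identity \<open>Dom h\<close>, taken as
  both halves of a nexus, shows that a choice exists.
\<close>

lemma Comp_cls:
  assumes gh: "g \<in> Arr G" "h \<in> Arr G" "Ran G g = Dom G h"
  shows "cls g \<cdot>\<^bsub>Q\<^esub> cls h = cls (g \<cdot>\<^bsub>G\<^esub> h)"
proof -
  have *: "cls (corestr G g' (Dom G a) \<cdot>\<^bsub>G\<^esub> a \<cdot>\<^bsub>G\<^esub> h') = cls (g \<cdot>\<^bsub>G\<^esub> h)"
    if g': "g' \<in> cls g" "h' \<in> cls h" and n: "nexus G K (Ran G g') (Dom G h') a p" for g' h' a p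
  proof -
    have arr: "g' \<in> Arr G" "h' \<in> Arr G" "cls g' = cls g" "cls h' = cls h"
      using g' gh by (simp_all add: mem_cls_iff)
    have a: "a \<in> K" "a \<in> Arr G" "Ran G a = Dom G h'" using n by (auto simp: nexus_def kernel_closed)
    have "cls (corestr G g' (Dom G a) \<cdot>\<^bsub>G\<^esub> (a \<cdot>\<^bsub>G\<^esub> h')) = cls (g \<cdot>\<^bsub>G\<^esub> h)"
      by (rule cls_of_Comp)
        (use gh arr a corestr_nexus[OF arr(1,2) n] in \<open>simp_all add: cls_kernel_Comp G.gsimps\<close>)
    then show ?thesis using arr a corestr_nexus[OF arr(1,2) n] by (simp add: G.gsimps)
  qed
  have "nexus G K (Ran G g) (Dom G h) (Dom G h) (Dom G h)"
    using gh by (simp add: nexus_def Ident_in_kernel G.gsimps G.Leq_refl)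
  then show ?thesis
    using * cls_self[OF gh(1)] cls_self[OF gh(2)]
    unfolding quot_def by (simp, intro the_equality) metis+
qed

lemma Leq_cls:
  assumes "g \<in> Arr G" "k \<in> Arr G"
  shows "cls g \<preceq>\<^bsub>Q\<^esub> cls k \<longleftrightarrow> below_mod G K g k"
proof -
  have "below_mod G K g k" if "g' \<in> cls g" "k' \<in> cls k" "below_mod G K g' k'" for g' k'
  proof -
    have "g' \<in> Arr G" "k' \<in> Arr G" "cls g' = cls g" "cls k' = cls k"
      using that assms by (simp_all add: mem_cls_iff)
    then show ?thesis
      using that(3) assms 
      by (simp add: below_mod_iff cls_eq_iff obj_equiv_def) (meson G.Dom_in_Idents obj_below_trans)
  qed
  then show ?thesis
    using cls_self[OF assms(1)] cls_self[OF assms(2)] unfolding quot_def by auto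
qed

lemma induced_Dom: "X \<in> Arr Q \<Longrightarrow> induced \<phi> (Dom Q X) = Dom H (induced \<phi> X)"
  and induced_Ran: "X \<in> Arr Q \<Longrightarrow> induced \<phi> (Ran Q X) = Ran H (induced \<phi> X)"
  and induced_closed: "X \<in> Arr Q \<Longrightarrow> induced \<phi> X \<in> Arr H"
  by (auto simp: Arr_Q Dom_cls Ran_cls map_cls map_simps G.gsimps)

text \<open>
  This reduces equations between composites in the quotient to equations in \<open>H\<close>.
\<close>

lemma Q_eqI:
  assumes "X \<in> Arr Q" "Y \<in> Arr Q" "Dom Q X = Dom Q Y" "induced \<phi> X = induced \<phi> Y"
  shows "X = Y"
proof -
  obtain g h where "g \<in> Arr G" "h \<in> Arr G" "X = cls g" "Y = cls h"
    using assms by (auto simp: Arr_Q)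
  then show ?thesis using assms by (simp add: Dom_cls map_cls cls_eq_iff G.gsimps)
qed

lemma Leq_Q_iff:
  assumes "X \<in> Arr Q" "Y \<in> Arr Q"
  shows "X \<preceq>\<^bsub>Q\<^esub> Y \<longleftrightarrow> Dom Q X \<preceq>\<^bsub>Q\<^esub> Dom Q Y \<and> induced \<phi> X \<preceq>\<^bsub>H\<^esub> induced \<phi> Y"
proof -
  obtain g k where gk: "g \<in> Arr G" "k \<in> Arr G" "X = cls g" "Y = cls k"
    using assms by (auto simp: Arr_Q)
  show ?thesis
    using gk obj_below_map[of "Dom G k" "Dom G g"]
    by (auto simp: Dom_cls Leq_cls below_mod_iff map_cls G.gsimps)
qed

lemma composable_in_Q:
  assumes "X \<in> Arr Q" "Y \<in> Arr Q" "Ran Q X = Dom Q Y"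
  obtains g h where "g \<in> Arr G" "h \<in> Arr G" "Ran G g = Dom G h" "X = cls g" "Y = cls h"
proof -
  obtain g h where gh: "g \<in> Arr G" "h \<in> Arr G" "X = cls g" "Y = cls h"
    using assms by (auto simp: Arr_Q)
  then have "cls (Ran G g) = cls (Dom G h)"
    using assms by (simp add: Ran_cls Dom_cls)
  from composable_representatives[OF gh(1,2) this]
  obtain g' h' where "g' \<in> Arr G" "h' \<in> Arr G" "Ran G g' = Dom G h'"
    "cls g' = cls g" "cls h' = cls h" by blast
  then show thesis using that[of g' h'] gh by simp
qed

lemma Comp_Q:
  assumes "X \<in> Arr Q" "Y \<in> Arr Q" "Ran Q X = Dom Q Y"
  shows "X \<cdot>\<^bsub>Q\<^esub> Y \<in> Arr Q" "Dom Q (X \<cdot>\<^bsub>Q\<^esub> Y) = Dom Q X" "Ran Q (X \<cdot>\<^bsub>Q\<^esub> Y) = Ran Q Y"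
    and induced_Comp: "induced \<phi> (X \<cdot>\<^bsub>Q\<^esub> Y) = induced \<phi> X \<cdot>\<^bsub>H\<^esub> induced \<phi> Y"
proof -
  obtain g h where gh: "g \<in> Arr G" "h \<in> Arr G" "Ran G g = Dom G h" "X = cls g" "Y = cls h"
    using composable_in_Q[OF assms] by blast
  then show "X \<cdot>\<^bsub>Q\<^esub> Y \<in> Arr Q" "Dom Q (X \<cdot>\<^bsub>Q\<^esub> Y) = Dom Q X" "Ran Q (X \<cdot>\<^bsub>Q\<^esub> Y) = Ran Q Y"
    "induced \<phi> (X \<cdot>\<^bsub>Q\<^esub> Y) = induced \<phi> X \<cdot>\<^bsub>H\<^esub> induced \<phi> Y"
    by (simp_all add: Comp_cls Dom_cls Ran_cls map_cls map_Comp cls_in_Arr_Q G.gsimps)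
qed

lemma groupoid_Q: "groupoid Q"
proof
  fix X Y assume XY: "X \<in> Arr Q" "Y \<in> Arr Q" "Ran Q X = Dom Q Y"
  show "X \<cdot>\<^bsub>Q\<^esub> Y \<in> Arr Q" "Dom Q (X \<cdot>\<^bsub>Q\<^esub> Y) = Dom Q X" "Ran Q (X \<cdot>\<^bsub>Q\<^esub> Y) = Ran Q Y"
    by (fact Comp_Q[OF XY])+
next
  fix X Y Z
  assume XYZ: "X \<in> Arr Q" "Y \<in> Arr Q" "Z \<in> Arr Q" "Ran Q X = Dom Q Y" "Ran Q Y = Dom Q Z"
  show "(X \<cdot>\<^bsub>Q\<^esub> Y) \<cdot>\<^bsub>Q\<^esub> Z = X \<cdot>\<^bsub>Q\<^esub> (Y \<cdot>\<^bsub>Q\<^esub> Z)"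
    by (rule Q_eqI; use XYZ in \<open>simp add: Comp_Q induced_Comp H.Comp_assoc induced_closed flip: induced_Dom induced_Ran\<close>)
next
  fix X assume "X \<in> Arr Q"
  then obtain g where g: "g \<in> Arr G" "X = cls g" by (auto simp: Arr_Q)
  have "is_inverse Q X (cls (Inv G g))"
    unfolding is_inverse_def using g by (simp add: Dom_cls Ran_cls Comp_cls cls_in_Arr_Q G.gsimps)
  then show "\<exists>Y. is_inverse Q X Y" ..
qed (auto simp: Arr_Q Dom_cls Ran_cls Comp_cls G.gsimps)

lemma Idents_Q: "Idents Q = cls ` Idents G"
proof
  show "Idents Q \<subseteq> cls ` Idents G"
  proof
    fix X assume "X \<in> Idents Q"
    then have X: "X \<in> Arr Q" "Dom Q X = X" by (simp_all add: Idents_def)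
    then obtain g where "g \<in> Arr G" "X = cls g" by (auto simp: Arr_Q)
    then show "X \<in> cls ` Idents G"
      using X(2) by (intro image_eqI[of _ _ "Dom G g"]) (simp_all add: Dom_cls G.ident_simps)
  qed
  show "cls ` Idents G \<subseteq> Idents Q"
    by (auto simp: Idents_def[of Q] Arr_Q Dom_cls G.ident_simps)
qed

lemma Inv_cls: "g \<in> Arr G \<Longrightarrow> Inv Q (cls g) = cls (Inv G g)"
  by (rule groupoid.Inv_eqI[OF groupoid_Q])
    (simp_all add: is_inverse_def Dom_cls Ran_cls Comp_cls cls_in_Arr_Q G.gsimps)

text \<open>
  Compatibility of the order with products and uniqueness of restrictions come from \<open>H\<close>, as
  the order is detected there and on the objects. Restrictions exist because a kernel arrow \<open>a\<close> that
  witnesses \<open>[e] \<preceq> [Dom g]\<close> starts at an object below \<open>Dom g\<close>, to which \<open>g\<close> can be restricted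
  in \<open>G\<close>.
\<close>

lemma ordered_groupoid_Q: "ordered_groupoid Q"
proof -
  have trans: "X \<preceq>\<^bsub>Q\<^esub> Z"
    if arr: "X \<in> Arr Q" "Y \<in> Arr Q" "Z \<in> Arr Q" and le: "X \<preceq>\<^bsub>Q\<^esub> Y" "Y \<preceq>\<^bsub>Q\<^esub> Z" for X Y Z
  proof -
    obtain g h k where "g \<in> Arr G" "h \<in> Arr G" "k \<in> Arr G" "X = cls g" "Y = cls h" "Z = cls k"
      using arr by (auto simp: Arr_Q)
    then show ?thesis
      using le obj_below_trans[of "Dom G h" "Dom G k" "Dom G g"]
        H.Leq_trans[of "\<phi> g" "\<phi> h" "\<phi> k"]
      by (simp add: Leq_cls below_mod_iff G.gsimps map_closed)
  qed
  interpret Q: groupoid Q by (rule groupoid_Q)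
  show ?thesis
  proof
    fix X assume "X \<in> Arr Q"
    then show "X \<preceq>\<^bsub>Q\<^esub> X"
      by (auto simp: Arr_Q Leq_cls below_mod_iff obj_below_refl H.Leq_refl map_closed G.gsimps)
  next
    fix X Y assume XY: "X \<in> Arr Q" "Y \<in> Arr Q" and le: "X \<preceq>\<^bsub>Q\<^esub> Y" "Y \<preceq>\<^bsub>Q\<^esub> X"
    obtain g h where "g \<in> Arr G" "h \<in> Arr G" "X = cls g" "Y = cls h"
      using XY by (auto simp: Arr_Q)
    then show "X = Y"
      using le by (simp add: Leq_cls cls_eq_iff equiv_mod_iff[symmetric] equiv_mod_def)
  next
    fix X Y assume "X \<in> Arr Q" "Y \<in> Arr Q" "X \<preceq>\<^bsub>Q\<^esub> Y"
    then show "Inv Q X \<preceq>\<^bsub>Q\<^esub> Inv Q Y"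
      by (auto simp: Arr_Q Inv_cls Leq_cls G.gsimps intro: below_mod_Inv)
  next
    fix X X' Y Y'
    assume *: "X \<in> Arr Q" "X' \<in> Arr Q" "Y \<in> Arr Q" "Y' \<in> Arr Q" "X \<preceq>\<^bsub>Q\<^esub> X'" "Y \<preceq>\<^bsub>Q\<^esub> Y'"
      "Ran Q X = Dom Q Y" "Ran Q X' = Dom Q Y'"
    have "induced \<phi> X \<cdot>\<^bsub>H\<^esub> induced \<phi> Y \<preceq>\<^bsub>H\<^esub> induced \<phi> X' \<cdot>\<^bsub>H\<^esub> induced \<phi> Y'"
      by (rule H.OG2) (use * in \<open>simp_all add: induced_closed Leq_Q_iff flip: induced_Dom induced_Ran\<close>)
    moreover have "Dom Q X \<preceq>\<^bsub>Q\<^esub> Dom Q X'"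
      using * Leq_Q_iff by blast
    ultimately show "X \<cdot>\<^bsub>Q\<^esub> Y \<preceq>\<^bsub>Q\<^esub> X' \<cdot>\<^bsub>Q\<^esub> Y'"
      using * Leq_Q_iff[of "X \<cdot>\<^bsub>Q\<^esub> Y" "X' \<cdot>\<^bsub>Q\<^esub> Y'"] by (simp add: Comp_Q induced_Comp)
  next
    fix X F assume X: "X \<in> Arr Q" and F: "F \<in> Idents Q" "F \<preceq>\<^bsub>Q\<^esub> Dom Q X"
    obtain g where g: "g \<in> Arr G" "X = cls g" using X by (auto simp: Arr_Q)
    obtain e where e: "e \<in> Idents G" "F = cls e" using F by (auto simp: Idents_Q)
    have "obj_below e (Dom G g)"
      using F g e by (simp add: Dom_cls Leq_cls below_mod_iff G.gsimps)
    then obtain a where a: "a \<in> K" "Ran G a = e" "Dom G a \<preceq>\<^bsub>G\<^esub> Dom G g"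
      by (auto simp: obj_below_def)
    have arr: "a \<in> Arr G" using a kernel_closed by blast
    let ?g = "restr G (Dom G a) g"
    have g': "?g \<in> Arr G" "?g \<preceq>\<^bsub>G\<^esub> g" "Dom G ?g = Dom G a"
      using a arr g by (simp_all add: G.restr_simps G.gsimps)
    have "below_mod G K ?g g"
      using g g' a arr by (simp add: below_mod_iff obj_below_if_le map_Leq G.gsimps)
    moreover have "cls (Dom G a) = F"
      using e a arr obj_equiv_kernel[OF a(1)] by (simp add: cls_Ident_iff G.gsimps)
    ultimately have ex: "cls ?g \<in> Arr Q \<and> cls ?g \<preceq>\<^bsub>Q\<^esub> X \<and> Dom Q (cls ?g) = F"
      using g g' by (simp add: Leq_cls Dom_cls cls_in_Arr_Q)
    have "Y = Z" if "Y \<in> Arr Q" "Y \<preceq>\<^bsub>Q\<^esub> X" "Dom Q Y = F" "Z \<in> Arr Q" "Z \<preceq>\<^bsub>Q\<^esub> X" "Dom Q Z = F"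
      for Y Z
    proof (rule Q_eqI)
      show "induced \<phi> Y = induced \<phi> Z"
        by (rule H.eq_if_le_and_Dom_eq[of _ _ "induced \<phi> X"])
          (use that X in \<open>simp_all add: induced_closed Leq_Q_iff flip: induced_Dom\<close>)
    qed (use that in simp_all)
    with ex show "\<exists>!Y. Y \<in> Arr Q \<and> Y \<preceq>\<^bsub>Q\<^esub> X \<and> Dom Q Y = F" by blast
  qed (use trans in blast)
qed

text \<open>
  If \<open>[g]\<close> starts at \<open>[e]\<close>, some kernel arrow \<open>p\<close> ends at \<open>e\<close> and starts below \<open>Dom g\<close>.
  Then \<open>p\<^sup>-\<^sup>1\<close>, followed by the restriction of \<open>g\<close> to \<open>Dom p\<close>, is a lift of \<open>[g]\<close> at \<open>e\<close>.
\<close>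

lemma fibration_cls: "fibration G Q cls"
proof -
  interpret Q: ordered_groupoid Q by (rule ordered_groupoid_Q)
  have is_functor: "ordered_functor G Q cls"
  proof
    fix g h assume gh: "g \<in> Arr G" "h \<in> Arr G" "g \<preceq>\<^bsub>G\<^esub> h"
    then show "cls g \<preceq>\<^bsub>Q\<^esub> cls h"
      using obj_below_if_le[of "Dom G g" "Dom G h"] G.Dom_mono[of g h]
      by (simp add: Leq_cls below_mod_iff map_Leq G.gsimps)
  qed (simp_all add: cls_in_Arr_Q Dom_cls Ran_cls Comp_cls)
  have "star_surjective G Q cls"
    unfolding star_surjective_def
  proof (intro ballI equalityI subsetI)
    fix e X assume "e \<in> Idents G" "X \<in> cls ` star G e"
    then show "X \<in> star Q (cls e)" by (auto simp: star_def cls_in_Arr_Q Dom_cls)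
  next
    fix e X assume e: "e \<in> Idents G" and "X \<in> star Q (cls e)"
    then obtain g where g: "g \<in> Arr G" "X = cls g" "cls (Dom G g) = cls e"
      by (auto simp: star_def Arr_Q Dom_cls)
    then obtain p where p: "p \<in> K" "Ran G p = e" "Dom G p \<preceq>\<^bsub>G\<^esub> Dom G g"
      using e by (auto simp: cls_Ident_iff obj_equiv_def obj_below_def G.gsimps)
    have arr: "p \<in> Arr G" using p kernel_closed by blast
    let ?g = "restr G (Dom G p) g"
    have g': "?g \<in> Arr G" "?g \<preceq>\<^bsub>G\<^esub> g" "Dom G ?g = Dom G p"
      using p arr g by (simp_all add: G.restr_simps G.gsimps)
    have "cls (Dom G p) = cls (Dom G g)"
      using obj_equiv_kernel[OF p(1)] p e g arr by (simp add: cls_Ident_iff[symmetric] G.gsimps)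
    moreover have "\<phi> ?g = \<phi> g"
      using map_eq_if_le[OF g'(1) g(1) g'(2)] g'(3) arr g(1)
        cls_eq_map[OF _ _ calculation] by (simp add: G.gsimps)
    ultimately have "cls ?g = X"
      using g(1,2) g' arr by (simp add: cls_eq_iff cls_Ident_iff G.gsimps)
    then have "cls (Inv G p \<cdot>\<^bsub>G\<^esub> ?g) = X"
      using cls_kernel_Comp[of "Inv G p" ?g] p arr g' by (simp add: Inv_in_kernel G.gsimps)
    then show "X \<in> cls ` star G e"
      using p arr g' by (intro image_eqI[of _ _ "Inv G p \<cdot>\<^bsub>G\<^esub> ?g"]) (simp_all add: star_def G.gsimps)
  qed
  with is_functor show ?thesis by (simp add: fibration_def)
qed

lemma ordered_functor_induced: "ordered_functor Q H (induced \<phi>)"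
proof -
  interpret Q: ordered_groupoid Q by (rule ordered_groupoid_Q)
  show ?thesis
    by unfold_locales (simp_all add: induced_closed induced_Dom induced_Ran induced_Comp Leq_Q_iff)
qed

lemma star_injective_induced: "star_injective Q (induced \<phi>)"
  unfolding star_injective_def inj_on_def star_def
  by (intro ballI impI, rule Q_eqI) simp_all

end

section \<open>The covering groupoid of a star-injective functor\<close>

locale star_injective_functor =
  U: ordered_groupoid U + H: ordered_groupoid H + ordered_functor U H \<psi>
  for U :: "'u ogpd" and H :: "'b ogpd" and \<psi> :: "'u \<Rightarrow> 'b" +
  assumes star_inj: "star_injective U \<psi>"
begin

abbreviation ten :: "'u \<Rightarrow> 'b \<Rightarrow> ('u \<times> 'b) set" (infix "\<otimes>" 65) where
  "e \<otimes> h \<equiv> tens U H \<psi> e h"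

abbreviation T :: "('b \<times> ('u \<times> 'b) set) ogpd" where
  "T \<equiv> Htilde U H \<psi>"

lemma arrow_eqI:
  assumes "u \<in> Arr U" "v \<in> Arr U" "Dom U u = Dom U v" "\<psi> u = \<psi> v"
  shows "u = v"
  using star_inj assms U.Dom_in_Idents[of v]
  unfolding star_injective_def inj_on_def star_def by auto

lemma Ident_if_map_Ident:
  assumes "u \<in> Arr U" "\<psi> u \<in> Idents H"
  shows "u \<in> Idents U"
proof -
  have "Dom U u = u"
    by (rule arrow_eqI) (use assms in \<open>simp_all add: map_simps U.gsimps H.gsimps\<close>)
  then show ?thesis using assms by (simp add: Idents_def)
qed

lemma box_iff: "(e, h) \<in> box U H \<psi> \<longleftrightarrow> e \<in> Idents U \<and> h \<in> Arr H \<and> \<psi> e = Dom H h"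
  by (simp add: box_def)

lemma Ident_in_box: "e \<in> Idents U \<Longrightarrow> (e, \<psi> e) \<in> box U H \<psi>"
  by (simp add: box_iff map_simps U.gsimps H.gsimps)

lemma act_in_box:
  "\<lbrakk>(e, h) \<in> box U H \<psi>; m \<in> Arr H; Ran H h = Dom H m\<rbrakk> \<Longrightarrow> (e, h \<cdot>\<^bsub>H\<^esub> m) \<in> box U H \<psi>"
  by (simp add: box_iff H.gsimps)

lemma mem_tens_iff:
  "(f, k) \<in> e \<otimes> h \<longleftrightarrow> (f, k) \<in> box U H \<psi> \<and>
    (\<exists>u \<in> Arr U. Dom U u = e \<and> Ran U u = f \<and> h = \<psi> u \<cdot>\<^bsub>H\<^esub> k)"
  by (auto simp: tens_def)

lemma mem_tens_self:
  assumes "(e, h) \<in> box U H \<psi>"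
  shows "(e, h) \<in> e \<otimes> h"
  unfolding mem_tens_iff using assms
  by (intro conjI bexI[of _ e]) (simp_all add: box_iff U.gsimps H.gsimps)

lemma mem_tens_sym:
  assumes "(e, h) \<in> box U H \<psi>" "(f, k) \<in> e \<otimes> h"
  shows "(e, h) \<in> f \<otimes> k"
proof -
  obtain u where u: "u \<in> Arr U" "Dom U u = e" "Ran U u = f" "h = \<psi> u \<cdot>\<^bsub>H\<^esub> k"
    and k: "(f, k) \<in> box U H \<psi>"
    using assms by (auto simp: mem_tens_iff)
  have "Ran H (\<psi> u) = Dom H k" using u k map_Ran[of u] by (simp add: box_iff)
  then have "k = \<psi> (Inv U u) \<cdot>\<^bsub>H\<^esub> h"
    using u k by (simp add: box_iff map_simps H.gsimps)
  then show ?thesis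
    unfolding mem_tens_iff using assms u
    by (intro conjI bexI[of _ "Inv U u"]) (simp_all add: U.gsimps)
qed

lemma mem_tens_trans:
  assumes "(f, k) \<in> e \<otimes> h" "(g, l) \<in> f \<otimes> k"
  shows "(g, l) \<in> e \<otimes> h"
proof -
  obtain u v where u: "u \<in> Arr U" "Dom U u = e" "Ran U u = f" "h = \<psi> u \<cdot>\<^bsub>H\<^esub> k"
    and v: "v \<in> Arr U" "Dom U v = f" "Ran U v = g" "k = \<psi> v \<cdot>\<^bsub>H\<^esub> l"
    and l: "(g, l) \<in> box U H \<psi>"
    using assms by (auto simp: mem_tens_iff)
  have "Ran H (\<psi> v) = Dom H l" using v l map_Ran[of v] by (simp add: box_iff)
  moreover have "Ran H (\<psi> u) = Dom H (\<psi> v)" using u v map_Ran[of u] map_Dom[of v] by simp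
  ultimately have "h = \<psi> (u \<cdot>\<^bsub>U\<^esub> v) \<cdot>\<^bsub>H\<^esub> l"
    using u v l by (simp add: map_simps H.gsimps box_iff)
  then show ?thesis
    unfolding mem_tens_iff using l u v
    by (intro conjI bexI[of _ "u \<cdot>\<^bsub>U\<^esub> v"]) (simp_all add: U.gsimps)
qed

lemma tens_eq_iff_mem:
  assumes "(e, h) \<in> box U H \<psi>" "(f, k) \<in> box U H \<psi>"
  shows "e \<otimes> h = f \<otimes> k \<longleftrightarrow> (f, k) \<in> e \<otimes> h"
proof
  assume "e \<otimes> h = f \<otimes> k"
  then show "(f, k) \<in> e \<otimes> h" using mem_tens_self[OF assms(2)] by simp
next
  assume *: "(f, k) \<in> e \<otimes> h"
  show "e \<otimes> h = f \<otimes> k"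
  proof (intro equalityI subsetI)
    fix p assume "p \<in> e \<otimes> h"
    then show "p \<in> f \<otimes> k"
      using mem_tens_trans[OF mem_tens_sym[OF assms(1) *]] by (cases p) simp
  next
    fix p assume "p \<in> f \<otimes> k"
    then show "p \<in> e \<otimes> h" using mem_tens_trans[OF *] by (cases p) simp
  qed
qed

lemma tens_eq_iff:
  assumes "(e, h) \<in> box U H \<psi>" "(f, k) \<in> box U H \<psi>"
  shows "e \<otimes> h = f \<otimes> k \<longleftrightarrow>
    (\<exists>u \<in> Arr U. Dom U u = e \<and> Ran U u = f \<and> h = \<psi> u \<cdot>\<^bsub>H\<^esub> k)"
  unfolding tens_eq_iff_mem[OF assms] mem_tens_iff using assms by blast

lemma mem_tens_iff_eq:
  assumes "(e, h) \<in> box U H \<psi>"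
  shows "(f, k) \<in> e \<otimes> h \<longleftrightarrow> (f, k) \<in> box U H \<psi> \<and> f \<otimes> k = e \<otimes> h"
  using tens_eq_iff_mem[OF assms, of f k] mem_tens_iff[of f k e h] by metis

lemma tens_eq_Ran:
  assumes "(e, h) \<in> box U H \<psi>" "(f, k) \<in> box U H \<psi>" "e \<otimes> h = f \<otimes> k"
  shows "Ran H h = Ran H k"
proof -
  obtain u where u: "u \<in> Arr U" "Ran U u = f" "h = \<psi> u \<cdot>\<^bsub>H\<^esub> k"
    using assms by (auto simp: tens_eq_iff)
  have "Ran H (\<psi> u) = Dom H k" using u assms map_Ran[of u] by (simp add: box_iff)
  then show ?thesis using u assms by (simp add: box_iff map_simps H.gsimps)
qed

lemma tens_eq_act:
  assumes "(e, h) \<in> box U H \<psi>" "(f, k) \<in> box U H \<psi>" "e \<otimes> h = f \<otimes> k"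
    and m: "m \<in> Arr H" "Ran H h = Dom H m"
  shows "e \<otimes> (h \<cdot>\<^bsub>H\<^esub> m) = f \<otimes> (k \<cdot>\<^bsub>H\<^esub> m)"
proof -
  obtain u where u: "u \<in> Arr U" "Dom U u = e" "Ran U u = f" "h = \<psi> u \<cdot>\<^bsub>H\<^esub> k"
    using assms by (auto simp: tens_eq_iff)
  have k: "Ran H k = Dom H m" using assms tens_eq_Ran by metis
  have "Ran H (\<psi> u) = Dom H k" using u assms map_Ran[of u] by (simp add: box_iff)
  then have "h \<cdot>\<^bsub>H\<^esub> m = \<psi> u \<cdot>\<^bsub>H\<^esub> (k \<cdot>\<^bsub>H\<^esub> m)"
    using u k assms(2) m by (simp add: box_iff map_simps H.gsimps)
  then show ?thesis
    using tens_eq_iff[OF act_in_box[OF assms(1) m] act_in_box[OF assms(2) m(1) k]] u by blast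
qed

text \<open>
  The arrow \<open>u\<close> itself relates the two representatives.
\<close>

lemma tens_map:
  assumes "u \<in> Arr U"
  shows "Dom U u \<otimes> \<psi> u = Ran U u \<otimes> \<psi> (Ran U u)"
proof -
  have "(Dom U u, \<psi> u) \<in> box U H \<psi>" "\<psi> u \<cdot>\<^bsub>H\<^esub> \<psi> (Ran U u) = \<psi> u"
    using assms by (simp_all add: box_iff map_simps U.gsimps H.gsimps)
  then show ?thesis
    using assms by (auto simp: tens_eq_iff Ident_in_box U.gsimps)
qed

lemma tens_act_eq:
  assumes "(e, h) \<in> box U H \<psi>" "m \<in> Arr H" "Ran H h = Dom H m"
  shows "tens_act U H \<psi> (e \<otimes> h) m = e \<otimes> (h \<cdot>\<^bsub>H\<^esub> m)"
  unfolding tens_act_def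
proof (rule the_equality)
  show "\<exists>(f, k) \<in> e \<otimes> h. e \<otimes> (h \<cdot>\<^bsub>H\<^esub> m) = f \<otimes> (k \<cdot>\<^bsub>H\<^esub> m)"
    using mem_tens_self[OF assms(1)] by blast
next
  fix Y assume "\<exists>(f, k) \<in> e \<otimes> h. Y = f \<otimes> (k \<cdot>\<^bsub>H\<^esub> m)"
  then obtain f k where "(f, k) \<in> e \<otimes> h" "Y = f \<otimes> (k \<cdot>\<^bsub>H\<^esub> m)" by blast
  then show "Y = e \<otimes> (h \<cdot>\<^bsub>H\<^esub> m)"
    using tens_eq_act[OF assms(1), of f k m] assms by (simp add: mem_tens_iff_eq)
qed

text \<open>
  The order is defined by comparing arbitrary representatives, whereas here the one on the larger
  side is prescribed. If \<open>u\<close> relates the larger representative that was used to the prescribed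
  one, then the restriction of \<open>u\<close> to the smaller object moves the smaller representative
  along. Transitivity depends on this.
\<close>

lemma tens_le_iff:
  assumes x: "(x, l) \<in> box U H \<psi>" and e: "(e, k) \<in> box U H \<psi>"
  shows "tens_le U H (x \<otimes> l) (e \<otimes> k) \<longleftrightarrow>
    (\<exists>x' l'. (x', l') \<in> box U H \<psi> \<and> x' \<otimes> l' = x \<otimes> l \<and> x' \<preceq>\<^bsub>U\<^esub> e \<and> l' \<preceq>\<^bsub>H\<^esub> k)"
proof
  assume "tens_le U H (x \<otimes> l) (e \<otimes> k)"
  then obtain x1 l1 e1 k1 where *: "(x1, l1) \<in> x \<otimes> l" "(e1, k1) \<in> e \<otimes> k"
    "x1 \<preceq>\<^bsub>U\<^esub> e1" "l1 \<preceq>\<^bsub>H\<^esub> k1"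
    by (auto simp: tens_le_def)
  have x1: "(x1, l1) \<in> box U H \<psi>" "x1 \<otimes> l1 = x \<otimes> l"
    and e1: "(e1, k1) \<in> box U H \<psi>" "e1 \<otimes> k1 = e \<otimes> k"
    using * by (simp_all add: mem_tens_iff_eq x e)
  obtain u where u: "u \<in> Arr U" "Dom U u = e1" "Ran U u = e" "k1 = \<psi> u \<cdot>\<^bsub>H\<^esub> k"
    using e1 e by (auto simp: tens_eq_iff)
  let ?v = "restr U x1 u"
  have v: "?v \<in> Arr U" "?v \<preceq>\<^bsub>U\<^esub> u" "Dom U ?v = x1"
    using u x1 * by (simp_all add: U.restr_simps box_iff)
  let ?l = "Inv H (\<psi> ?v) \<cdot>\<^bsub>H\<^esub> l1"
  have dom: "Dom H (\<psi> ?v) = Dom H l1" using map_Dom[of ?v] x1 v by (simp add: box_iff)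
  have ran: "Ran H (\<psi> u) = Dom H k" using map_Ran[of u] e u by (simp add: box_iff)
  have arr: "l1 \<in> Arr H" "k \<in> Arr H" "k1 \<in> Arr H" "Dom H k1 = Dom H (\<psi> u)"
    using x1 e e1 u ran by (auto simp: box_iff map_simps H.gsimps)
  have box': "(Ran U ?v, ?l) \<in> box U H \<psi>"
    using v arr dom by (simp add: box_iff map_simps U.gsimps H.gsimps)
  moreover have "Ran U ?v \<otimes> ?l = x \<otimes> l"
  proof -
    have "l1 = \<psi> ?v \<cdot>\<^bsub>H\<^esub> ?l" using v arr dom by (simp add: map_simps H.gsimps)
    then have "x1 \<otimes> l1 = Ran U ?v \<otimes> ?l"
      using tens_eq_iff[OF x1(1) box'] v by blast
    then show ?thesis using x1 by simp
  qed
  moreover have "Ran U ?v \<preceq>\<^bsub>U\<^esub> e" using U.Ran_mono v u by metis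
  moreover have "?l \<preceq>\<^bsub>H\<^esub> k"
  proof -
    have "Inv H (\<psi> ?v) \<cdot>\<^bsub>H\<^esub> l1 \<preceq>\<^bsub>H\<^esub> Inv H (\<psi> u) \<cdot>\<^bsub>H\<^esub> k1"
      by (rule H.OG2)
        (use v u arr dom * in \<open>simp_all add: map_closed H.gsimps H.OG1 map_Leq\<close>)
    then show ?thesis using u ran arr by (simp add: map_closed H.gsimps)
  qed
  ultimately show "\<exists>x' l'. (x', l') \<in> box U H \<psi> \<and> x' \<otimes> l' = x \<otimes> l \<and> x' \<preceq>\<^bsub>U\<^esub> e \<and> l' \<preceq>\<^bsub>H\<^esub> k"
    by blast
next
  assume "\<exists>x' l'. (x', l') \<in> box U H \<psi> \<and> x' \<otimes> l' = x \<otimes> l \<and> x' \<preceq>\<^bsub>U\<^esub> e \<and> l' \<preceq>\<^bsub>H\<^esub> k"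
  then obtain x' l' where "(x', l') \<in> x \<otimes> l" "x' \<preceq>\<^bsub>U\<^esub> e" "l' \<preceq>\<^bsub>H\<^esub> k"
    using mem_tens_iff_eq[OF x] by blast
  then show "tens_le U H (x \<otimes> l) (e \<otimes> k)"
    unfolding tens_le_def using mem_tens_self[OF e] by blast
qed

lemma tens_leI:
  assumes "(x, l) \<in> box U H \<psi>" "(e, k) \<in> box U H \<psi>" "x \<preceq>\<^bsub>U\<^esub> e" "l \<preceq>\<^bsub>H\<^esub> k"
  shows "tens_le U H (x \<otimes> l) (e \<otimes> k)"
  using assms tens_le_iff by blast

lemma tens_leE:
  assumes "tens_le U H (x \<otimes> l) (e \<otimes> k)" "(x, l) \<in> box U H \<psi>" "(e, k) \<in> box U H \<psi>"
  obtains x' l' where "(x', l') \<in> box U H \<psi>" "x' \<otimes> l' = x \<otimes> l" "x' \<preceq>\<^bsub>U\<^esub> e" "l' \<preceq>\<^bsub>H\<^esub> k"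
  using assms tens_le_iff by blast

lemma tens_le_refl: "(e, k) \<in> box U H \<psi> \<Longrightarrow> tens_le U H (e \<otimes> k) (e \<otimes> k)"
  by (rule tens_leI) (auto simp: box_iff U.gsimps intro: U.Leq_refl H.Leq_refl)

lemma tens_le_trans:
  assumes "(x, l) \<in> box U H \<psi>" "(e, k) \<in> box U H \<psi>" "(f, m) \<in> box U H \<psi>"
    and "tens_le U H (x \<otimes> l) (e \<otimes> k)" "tens_le U H (e \<otimes> k) (f \<otimes> m)"
  shows "tens_le U H (x \<otimes> l) (f \<otimes> m)"
proof -
  obtain e' k' where e': "(e', k') \<in> box U H \<psi>" "e' \<otimes> k' = e \<otimes> k" "e' \<preceq>\<^bsub>U\<^esub> f" "k' \<preceq>\<^bsub>H\<^esub> m"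
    using assms tens_leE[of e k f m] by blast
  then have "tens_le U H (x \<otimes> l) (e' \<otimes> k')" using assms by simp
  then obtain x' l' where x': "(x', l') \<in> box U H \<psi>" "x' \<otimes> l' = x \<otimes> l" "x' \<preceq>\<^bsub>U\<^esub> e'" "l' \<preceq>\<^bsub>H\<^esub> k'"
    using assms e' tens_leE[of x l e' k'] by blast
  have "x' \<preceq>\<^bsub>U\<^esub> f" "l' \<preceq>\<^bsub>H\<^esub> m"
    using U.Leq_trans[of x' e' f] H.Leq_trans[of l' k' m] x' e' assms
    by (simp_all add: box_iff U.gsimps)
  then have "tens_le U H (x' \<otimes> l') (f \<otimes> m)" using tens_leI x' assms by blast
  then show ?thesis using x' by simp
qed

text \<open>
  Two inequalities produce a representative \<open>(x', l')\<close> of \<open>x \<otimes> l\<close> that lies below \<open>(x, l)\<close>.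
  As the ranges of \<open>l'\<close> and \<open>l\<close> agree, \<open>l' = l\<close>, so the arrow of \<open>U\<close> that relates the two
  representatives has an identity as its image. By star-injectivity it is an identity, and so
  everything in between collapses to \<open>(x, l)\<close>.
\<close>

lemma tens_le_antisym:
  assumes x: "(x, l) \<in> box U H \<psi>" and e: "(e, k) \<in> box U H \<psi>"
    and le: "tens_le U H (x \<otimes> l) (e \<otimes> k)" "tens_le U H (e \<otimes> k) (x \<otimes> l)"
  shows "x \<otimes> l = e \<otimes> k"
proof -
  obtain e' k' where e': "(e', k') \<in> box U H \<psi>" "e' \<otimes> k' = e \<otimes> k" "e' \<preceq>\<^bsub>U\<^esub> x" "k' \<preceq>\<^bsub>H\<^esub> l"
    using assms tens_leE[of e k x l] by blast
  then have "tens_le U H (x \<otimes> l) (e' \<otimes> k')" using le by simp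
  then obtain x' l' where x': "(x', l') \<in> box U H \<psi>" "x' \<otimes> l' = x \<otimes> l" "x' \<preceq>\<^bsub>U\<^esub> e'" "l' \<preceq>\<^bsub>H\<^esub> k'"
    using x e' tens_leE[of x l e' k'] by blast
  have le': "x' \<preceq>\<^bsub>U\<^esub> x" "l' \<preceq>\<^bsub>H\<^esub> l"
    using U.Leq_trans[of x' e' x] H.Leq_trans[of l' k' l] x' e' x
    by (simp_all add: box_iff U.gsimps)
  have arr: "l \<in> Arr H" "l' \<in> Arr H" "k' \<in> Arr H" "x \<in> Idents U" "x' \<in> Idents U" "e' \<in> Idents U"
    using x x' e' by (simp_all add: box_iff)
  have l: "l' = l"
    using H.eq_if_le_and_Ran_eq[OF arr(2,1,1) le'(2)] arr tens_eq_Ran[OF x'(1) x x'(2)]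
    by (simp add: H.Leq_refl)
  obtain u where u: "u \<in> Arr U" "Dom U u = x'" "Ran U u = x" "l = \<psi> u \<cdot>\<^bsub>H\<^esub> l"
    using x x' l by (auto simp: tens_eq_iff)
  have ran: "Ran H (\<psi> u) = Dom H l" using map_Ran[of u] u x by (simp add: box_iff)
  have "\<psi> u = (\<psi> u \<cdot>\<^bsub>H\<^esub> l) \<cdot>\<^bsub>H\<^esub> Inv H l"
    using u(1) ran arr by (simp add: map_closed H.gsimps)
  also have "\<dots> = l \<cdot>\<^bsub>H\<^esub> Inv H l" by (simp only: u(4)[symmetric])
  also have "\<dots> = Dom H l" using arr by (simp add: H.gsimps)
  finally have "u \<in> Idents U" using u arr Ident_if_map_Ident by (simp add: H.gsimps)
  then have "x' = x" using u by (simp add: U.gsimps)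
  then have "e' = x" "k' = l"
    using U.Leq_antisym[of e' x] H.Leq_antisym[of k' l] x' e' l arr by (simp_all add: U.gsimps)
  then show ?thesis using e' by simp
qed

lemma tens_le_act:
  assumes x: "(x, l) \<in> box U H \<psi>" and e: "(e, k) \<in> box U H \<psi>"
    and le: "tens_le U H (x \<otimes> l) (e \<otimes> k)"
    and mn: "m \<in> Arr H" "n \<in> Arr H" "m \<preceq>\<^bsub>H\<^esub> n" "Ran H l = Dom H m" "Ran H k = Dom H n"
  shows "tens_le U H (x \<otimes> (l \<cdot>\<^bsub>H\<^esub> m)) (e \<otimes> (k \<cdot>\<^bsub>H\<^esub> n))"
proof -
  obtain x' l' where x': "(x', l') \<in> box U H \<psi>" "x' \<otimes> l' = x \<otimes> l" "x' \<preceq>\<^bsub>U\<^esub> e" "l' \<preceq>\<^bsub>H\<^esub> k"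
    using assms tens_leE[of x l e k] by blast
  have ran: "Ran H l' = Dom H m" using tens_eq_Ran[OF x'(1) x x'(2)] mn by simp
  have "tens_le U H (x' \<otimes> (l' \<cdot>\<^bsub>H\<^esub> m)) (e \<otimes> (k \<cdot>\<^bsub>H\<^esub> n))"
    by (rule tens_leI)
      (use x' e mn ran in \<open>simp_all add: act_in_box\<close>, auto simp: box_iff intro: H.OG2)
  then show ?thesis using tens_eq_act[OF x'(1) x x'(2) mn(1) ran] by simp
qed

lemma Arr_T_iff: "t \<in> Arr T \<longleftrightarrow>
    (\<exists>k e h. t = (k, e \<otimes> h) \<and> k \<in> Arr H \<and> (e, h) \<in> box U H \<psi> \<and> Ran H k = Ran H h)"
  by (auto simp: Htilde_def)

lemma ArrT_E:
  assumes "t \<in> Arr T"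
  obtains k e h where "t = (k, e \<otimes> h)" "k \<in> Arr H" "(e, h) \<in> box U H \<psi>" "Ran H k = Ran H h"
  using assms by (auto simp: Arr_T_iff)

lemma pair_in_Arr_T:
  assumes "(e, h) \<in> box U H \<psi>" "k \<in> Arr H" "Ran H k = Ran H h"
  shows "(k, e \<otimes> h) \<in> Arr T"
  using assms by (auto simp: Arr_T_iff)

lemma box_arrow: "(e, h) \<in> box U H \<psi> \<Longrightarrow> h \<in> Arr H"
  by (simp add: box_iff)

lemma Dom_T:
  "\<lbrakk>(e, h) \<in> box U H \<psi>; k \<in> Arr H; Ran H k = Ran H h\<rbrakk> \<Longrightarrow>
    Dom T (k, e \<otimes> h) = (Dom H k, e \<otimes> (h \<cdot>\<^bsub>H\<^esub> Inv H k))"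
  by (simp add: Htilde_def tens_act_eq H.gsimps)

lemma Ran_T: "Ran T (k, X) = (Ran H k, X)"
  and Comp_T: "(k, X) \<cdot>\<^bsub>T\<^esub> (m, Y) = (k \<cdot>\<^bsub>H\<^esub> m, Y)"
  and Leq_T: "(k, X) \<preceq>\<^bsub>T\<^esub> (m, Y) \<longleftrightarrow> k \<preceq>\<^bsub>H\<^esub> m \<and> tens_le U H X Y"
  by (simp_all add: Htilde_def)

lemma Idents_T_E:
  assumes "t \<in> Idents T"
  obtains e h where "t = (Ran H h, e \<otimes> h)" "(e, h) \<in> box U H \<psi>"
proof -
  have "t \<in> Arr T" "Dom T t = t" using assms by (simp_all add: Idents_def)
  then obtain k e h where t: "t = (k, e \<otimes> h)" "k \<in> Arr H" "(e, h) \<in> box U H \<psi>" "Ran H k = Ran H h"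
    by (elim ArrT_E)
  then have "Dom H k = k" using \<open>Dom T t = t\<close> by (simp add: Dom_T)
  then have "k = Ran H h" using t H.Ran_Dom[of k] by simp
  then show thesis using that t by blast
qed

lemma composable_T:
  assumes "s \<in> Arr T" "t \<in> Arr T" "Ran T s = Dom T t"
  obtains k m f l where "s = (k, f \<otimes> (l \<cdot>\<^bsub>H\<^esub> Inv H m))" "t = (m, f \<otimes> l)"
    "k \<in> Arr H" "m \<in> Arr H" "(f, l) \<in> box U H \<psi>" "Ran H k = Dom H m" "Ran H m = Ran H l"
proof -
  obtain k e h where s: "s = (k, e \<otimes> h)" "k \<in> Arr H"
    using assms(1) by (elim ArrT_E)
  obtain m f l where t: "t = (m, f \<otimes> l)" "m \<in> Arr H" "(f, l) \<in> box U H \<psi>" "Ran H m = Ran H l"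
    using assms(2) by (elim ArrT_E)
  show thesis
    using that[of k f l m] s t assms(3) by (simp add: Ran_T Dom_T)
qed

lemma is_inverse_T:
  assumes "(e, h) \<in> box U H \<psi>" "k \<in> Arr H" "Ran H k = Ran H h"
  shows "is_inverse T (k, e \<otimes> h) (Inv H k, e \<otimes> (h \<cdot>\<^bsub>H\<^esub> Inv H k))"
  using assms box_arrow[of e h]
  by (simp add: is_inverse_def Ran_T Dom_T Comp_T pair_in_Arr_T act_in_box H.gsimps)

lemma groupoid_T: "groupoid T"
proof
  fix t assume "t \<in> Arr T"
  then obtain k e h where t: "t = (k, e \<otimes> h)" "k \<in> Arr H" "(e, h) \<in> box U H \<psi>" "Ran H k = Ran H h"
    by (elim ArrT_E)
  have h: "h \<in> Arr H" using t box_arrow by blast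
  show "Dom T t \<in> Arr T" "Ran T t \<in> Arr T" "Dom T (Dom T t) = Dom T t" "Ran T (Dom T t) = Dom T t"
    "Dom T (Ran T t) = Ran T t" "Ran T (Ran T t) = Ran T t"
    "Dom T t \<cdot>\<^bsub>T\<^esub> t = t" "t \<cdot>\<^bsub>T\<^esub> Ran T t = t"
    using t h by (simp_all add: Dom_T Ran_T Comp_T pair_in_Arr_T act_in_box H.gsimps)
  show "\<exists>s. is_inverse T t s" using is_inverse_T t by blast
next
  fix s t assume *: "s \<in> Arr T" "t \<in> Arr T" "Ran T s = Dom T t"
  obtain k m f l where st: "s = (k, f \<otimes> (l \<cdot>\<^bsub>H\<^esub> Inv H m))" "t = (m, f \<otimes> l)"
    "k \<in> Arr H" "m \<in> Arr H" "(f, l) \<in> box U H \<psi>" "Ran H k = Dom H m" "Ran H m = Ran H l"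
    using * by (rule composable_T)
  have l: "l \<in> Arr H" using st box_arrow by blast
  show "s \<cdot>\<^bsub>T\<^esub> t \<in> Arr T" "Dom T (s \<cdot>\<^bsub>T\<^esub> t) = Dom T s" "Ran T (s \<cdot>\<^bsub>T\<^esub> t) = Ran T t"
    using st l
    by (simp_all add: Dom_T Ran_T Comp_T pair_in_Arr_T act_in_box H.gsimps H.Inv_of_Comp)
next
  fix r s t assume rst: "r \<in> Arr T" "s \<in> Arr T" "t \<in> Arr T" "Ran T r = Dom T s" "Ran T s = Dom T t"
  obtain k X where "r = (k, X)" "k \<in> Arr H"
    using rst(1) by (elim ArrT_E)
  moreover obtain m f l where "s = (m, f \<otimes> l)" "m \<in> Arr H" "(f, l) \<in> box U H \<psi>" "Ran H m = Ran H l"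
    using rst(2) by (elim ArrT_E)
  moreover obtain n g j where "t = (n, g \<otimes> j)" "n \<in> Arr H" "(g, j) \<in> box U H \<psi>" "Ran H n = Ran H j"
    using rst(3) by (elim ArrT_E)
  ultimately show "(r \<cdot>\<^bsub>T\<^esub> s) \<cdot>\<^bsub>T\<^esub> t = r \<cdot>\<^bsub>T\<^esub> (s \<cdot>\<^bsub>T\<^esub> t)"
    using rst(4,5) by (simp add: Ran_T Dom_T Comp_T H.gsimps)
qed

lemma Inv_T:
  "\<lbrakk>(e, h) \<in> box U H \<psi>; k \<in> Arr H; Ran H k = Ran H h\<rbrakk> \<Longrightarrow>
    Inv T (k, e \<otimes> h) = (Inv H k, e \<otimes> (h \<cdot>\<^bsub>H\<^esub> Inv H k))"
  by (rule groupoid.Inv_eqI[OF groupoid_T]) (simp_all add: is_inverse_T pair_in_Arr_T)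

lemma tens_act_Inv_cancel:
  assumes "(e, h) \<in> box U H \<psi>" "k \<in> Arr H" "Ran H k = Ran H h"
  shows "e \<otimes> ((h \<cdot>\<^bsub>H\<^esub> Inv H k) \<cdot>\<^bsub>H\<^esub> k) = e \<otimes> h"
  using assms box_arrow[of e h] by (simp add: H.gsimps)

text \<open>
  For the restriction axiom, a restriction of \<open>(k, X)\<close> must have the restriction of \<open>k\<close> as its
  first component, and its second component is the image of the given object under the action of
  that arrow: the action can be undone, so the domain determines it.
\<close>

lemma ordered_groupoid_T: "ordered_groupoid T"
proof -
  interpret T: groupoid T by (rule groupoid_T)
  show ?thesis
  proof
    fix t assume "t \<in> Arr T"
    then show "t \<preceq>\<^bsub>T\<^esub> t"
      by (elim ArrT_E) (simp add: Leq_T tens_le_refl H.Leq_refl)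
  next
    fix s t assume st: "s \<in> Arr T" "t \<in> Arr T" and le: "s \<preceq>\<^bsub>T\<^esub> t" "t \<preceq>\<^bsub>T\<^esub> s"
    obtain k e h where s: "s = (k, e \<otimes> h)" "k \<in> Arr H" "(e, h) \<in> box U H \<psi>"
      using st(1) by (elim ArrT_E)
    obtain m f l where t: "t = (m, f \<otimes> l)" "m \<in> Arr H" "(f, l) \<in> box U H \<psi>"
      using st(2) by (elim ArrT_E)
    show "s = t"
      using le s t tens_le_antisym[of e h f l] H.Leq_antisym[of k m] by (simp add: Leq_T)
  next
    fix r s t
    assume rst: "r \<in> Arr T" "s \<in> Arr T" "t \<in> Arr T" and le: "r \<preceq>\<^bsub>T\<^esub> s" "s \<preceq>\<^bsub>T\<^esub> t"
    obtain k e h where r: "r = (k, e \<otimes> h)" "k \<in> Arr H" "(e, h) \<in> box U H \<psi>"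
      using rst(1) by (elim ArrT_E)
    obtain m f l where s: "s = (m, f \<otimes> l)" "m \<in> Arr H" "(f, l) \<in> box U H \<psi>"
      using rst(2) by (elim ArrT_E)
    obtain n g j where t: "t = (n, g \<otimes> j)" "n \<in> Arr H" "(g, j) \<in> box U H \<psi>"
      using rst(3) by (elim ArrT_E)
    show "r \<preceq>\<^bsub>T\<^esub> t"
      using le r s t tens_le_trans[of e h f l g j] H.Leq_trans[of k m n] by (simp add: Leq_T)
  next
    fix s t assume st: "s \<in> Arr T" "t \<in> Arr T" "s \<preceq>\<^bsub>T\<^esub> t"
    obtain k e h where s: "s = (k, e \<otimes> h)" "k \<in> Arr H" "(e, h) \<in> box U H \<psi>" "Ran H k = Ran H h"
      using st(1) by (elim ArrT_E)
    obtain m f l where t: "t = (m, f \<otimes> l)" "m \<in> Arr H" "(f, l) \<in> box U H \<psi>" "Ran H m = Ran H l"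
      using st(2) by (elim ArrT_E)
    show "Inv T s \<preceq>\<^bsub>T\<^esub> Inv T t"
      using s t st(3) by (simp add: Inv_T Leq_T H.OG1 tens_le_act H.gsimps)
  next
    fix s s' t t'
    assume *: "s \<in> Arr T" "s' \<in> Arr T" "t \<in> Arr T" "t' \<in> Arr T" "s \<preceq>\<^bsub>T\<^esub> s'" "t \<preceq>\<^bsub>T\<^esub> t'"
      "Ran T s = Dom T t" "Ran T s' = Dom T t'"
    obtain k m f l where st: "s = (k, f \<otimes> (l \<cdot>\<^bsub>H\<^esub> Inv H m))" "t = (m, f \<otimes> l)"
      "k \<in> Arr H" "m \<in> Arr H" "Ran H k = Dom H m"
      using *(1,3,7) by (rule composable_T)
    obtain k' m' f' l' where st': "s' = (k', f' \<otimes> (l' \<cdot>\<^bsub>H\<^esub> Inv H m'))" "t' = (m', f' \<otimes> l')"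
      "k' \<in> Arr H" "m' \<in> Arr H" "Ran H k' = Dom H m'"
      using *(2,4,8) by (rule composable_T)
    show "s \<cdot>\<^bsub>T\<^esub> t \<preceq>\<^bsub>T\<^esub> s' \<cdot>\<^bsub>T\<^esub> t'"
      using st st' *(5,6) by (simp add: Comp_T Leq_T H.OG2)
  next
    fix t d assume t: "t \<in> Arr T" and d: "d \<in> Idents T" "d \<preceq>\<^bsub>T\<^esub> Dom T t"
    obtain k e h where t': "t = (k, e \<otimes> h)" "k \<in> Arr H" "(e, h) \<in> box U H \<psi>" "Ran H k = Ran H h"
      using t by (elim ArrT_E)
    obtain f l where d': "d = (Ran H l, f \<otimes> l)" "(f, l) \<in> box U H \<psi>"
      using d by (elim Idents_T_E)
    have arr: "h \<in> Arr H" "l \<in> Arr H" using t' d' box_arrow by auto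
    have le: "Ran H l \<preceq>\<^bsub>H\<^esub> Dom H k" "tens_le U H (f \<otimes> l) (e \<otimes> (h \<cdot>\<^bsub>H\<^esub> Inv H k))"
      using d(2) t' d' by (simp_all add: Dom_T Leq_T)
    let ?k = "restr H (Ran H l) k"
    have k: "?k \<in> Arr H" "?k \<preceq>\<^bsub>H\<^esub> k" "Dom H ?k = Ran H l"
      using le t' arr by (simp_all add: H.restr_simps H.gsimps)
    have "tens_le U H (f \<otimes> (l \<cdot>\<^bsub>H\<^esub> ?k)) (e \<otimes> ((h \<cdot>\<^bsub>H\<^esub> Inv H k) \<cdot>\<^bsub>H\<^esub> k))"
      by (rule tens_le_act)
        (use le k t' d' arr in \<open>simp_all add: act_in_box H.gsimps\<close>)
    then have ex: "(?k, f \<otimes> (l \<cdot>\<^bsub>H\<^esub> ?k)) \<in> Arr T \<and> (?k, f \<otimes> (l \<cdot>\<^bsub>H\<^esub> ?k)) \<preceq>\<^bsub>T\<^esub> t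
      \<and> Dom T (?k, f \<otimes> (l \<cdot>\<^bsub>H\<^esub> ?k)) = d"
      using k t' d' arr
      by (simp add: tens_act_Inv_cancel pair_in_Arr_T act_in_box Dom_T Leq_T H.gsimps)
    have unique: "s = (?k, f \<otimes> (l \<cdot>\<^bsub>H\<^esub> ?k))" if s: "s \<in> Arr T" "s \<preceq>\<^bsub>T\<^esub> t" "Dom T s = d" for s
    proof -
      obtain m g j where s': "s = (m, g \<otimes> j)" "m \<in> Arr H" "(g, j) \<in> box U H \<psi>" "Ran H m = Ran H j"
        using s(1) by (elim ArrT_E)
      have m: "Dom H m = Ran H l" "g \<otimes> (j \<cdot>\<^bsub>H\<^esub> Inv H m) = f \<otimes> l"
        using s(3) s' d' by (simp_all add: Dom_T)
      have "m = ?k"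
        by (rule H.eq_if_le_and_Dom_eq[of _ _ k]) (use s s' t' k m in \<open>simp_all add: Leq_T\<close>)
      moreover have "g \<otimes> ((j \<cdot>\<^bsub>H\<^esub> Inv H m) \<cdot>\<^bsub>H\<^esub> m) = f \<otimes> (l \<cdot>\<^bsub>H\<^esub> m)"
        by (rule tens_eq_act)
          (use m s' d' box_arrow[of g j] in \<open>simp_all add: act_in_box H.gsimps\<close>)
      ultimately show ?thesis using s' by (simp add: tens_act_Inv_cancel)
    qed
    show "\<exists>!s. s \<in> Arr T \<and> s \<preceq>\<^bsub>T\<^esub> t \<and> Dom T s = d"
      using ex unique by blast
  qed
qed

sublocale T: ordered_groupoid T
  by (rule ordered_groupoid_T)

text \<open>
  The inverse of the projection on the star of \<open>f \<otimes> l\<close> is \<open>k \<mapsto> (k, f \<otimes> lk)\<close>.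
\<close>

lemma covering_fst: "covering T H fst"
proof -
  have "ordered_functor T H fst"
  proof
    fix t assume "t \<in> Arr T"
    then show "fst t \<in> Arr H" "fst (Dom T t) = Dom H (fst t)" "fst (Ran T t) = Ran H (fst t)"
      by (elim ArrT_E, simp add: Dom_T Ran_T)+
  next
    fix s t show "fst (s \<cdot>\<^bsub>T\<^esub> t) = fst s \<cdot>\<^bsub>H\<^esub> fst t"
      by (cases s, cases t) (simp add: Comp_T)
  next
    fix s t assume "s \<preceq>\<^bsub>T\<^esub> t"
    then show "fst s \<preceq>\<^bsub>H\<^esub> fst t" by (cases s, cases t) (simp add: Leq_T)
  qed
  moreover have "bij_betw fst (star T d) (star H (fst d))" if id: "d \<in> Idents T" for d
  proof -
    obtain f l where d: "d = (Ran H l, f \<otimes> l)" "(f, l) \<in> box U H \<psi>"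
      using id by (elim Idents_T_E)
    have arr: "l \<in> Arr H" using d box_arrow by blast
    have form: "k \<in> Arr H \<and> Dom H k = Ran H l \<and> t = (k, f \<otimes> (l \<cdot>\<^bsub>H\<^esub> k))"
      if "t \<in> star T d" "k = fst t" for t k
    proof -
      have t: "t \<in> Arr T" "Dom T t = d" using that by (simp_all add: star_def)
      obtain m g j where t': "t = (m, g \<otimes> j)" "m \<in> Arr H" "(g, j) \<in> box U H \<psi>" "Ran H m = Ran H j"
        using t(1) by (elim ArrT_E)
      have m: "Dom H m = Ran H l" "g \<otimes> (j \<cdot>\<^bsub>H\<^esub> Inv H m) = f \<otimes> l"
        using t t' d by (simp_all add: Dom_T)
      have "g \<otimes> ((j \<cdot>\<^bsub>H\<^esub> Inv H m) \<cdot>\<^bsub>H\<^esub> m) = f \<otimes> (l \<cdot>\<^bsub>H\<^esub> m)"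
        by (rule tens_eq_act)
          (use m t' d box_arrow[of g j] in \<open>simp_all add: act_in_box H.gsimps\<close>)
      then show ?thesis using t' m that(2) by (simp add: tens_act_Inv_cancel)
    qed
    show ?thesis
    proof (rule bij_betw_byWitness[where f' = "\<lambda>k. (k, f \<otimes> (l \<cdot>\<^bsub>H\<^esub> k))"])
      show "\<forall>t \<in> star T d. (fst t, f \<otimes> (l \<cdot>\<^bsub>H\<^esub> fst t)) = t"
        using form by metis
      show "fst ` star T d \<subseteq> star H (fst d)"
        using form d by (auto simp: star_def[of H])
      show "(\<lambda>k. (k, f \<otimes> (l \<cdot>\<^bsub>H\<^esub> k))) ` star H (fst d) \<subseteq> star T d"
        using d arr by (auto simp: star_def pair_in_Arr_T act_in_box Dom_T H.gsimps)
    qed simp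
  qed
  ultimately show ?thesis by (simp add: covering_def star_bijective_def)
qed

abbreviation i :: "'u \<Rightarrow> 'b \<times> ('u \<times> 'b) set" where "i \<equiv> incl U H \<psi>"

text \<open>
  In this form the second component depends only on the range of \<open>u\<close>, which makes
  compatibility with composition evident.
\<close>

lemma incl_eq: "u \<in> Arr U \<Longrightarrow> i u = (\<psi> u, Ran U u \<otimes> \<psi> (Ran U u))"
  by (simp add: incl_def tens_map)

lemma incl_Ident: "e \<in> Idents U \<Longrightarrow> i e = (\<psi> e, e \<otimes> \<psi> e)"
  by (simp add: incl_eq U.gsimps)

lemma incl_closed: "u \<in> Arr U \<Longrightarrow> i u \<in> Arr T"
  using pair_in_Arr_T[OF Ident_in_box[of "Ran U u"], of "\<psi> u"]
  by (simp add: incl_eq map_simps U.gsimps H.gsimps)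

lemma incl_Dom:
  assumes "u \<in> Arr U"
  shows "i (Dom U u) = Dom T (i u)"
proof -
  have "(Dom U u, \<psi> u) \<in> box U H \<psi>" using assms by (simp add: box_iff map_simps U.gsimps)
  then show ?thesis
    using assms by (simp add: incl_Ident incl_def[of _ _ _ u] Dom_T map_simps U.gsimps H.gsimps)
qed

lemma incl_Ran: "u \<in> Arr U \<Longrightarrow> i (Ran U u) = Ran T (i u)"
  by (simp add: incl_eq Ran_T map_Ran U.gsimps)

lemma incl_Idents: "e \<in> Idents U \<Longrightarrow> i e \<in> Idents T"
  using incl_closed[of e] incl_Dom[of e] by (simp add: Idents_def)

text \<open>
  To reflect the order, an inequality of end points first yields an arrow \<open>w\<close> of \<open>U\<close> whose
  image is an identity. By star-injectivity \<open>w\<close> is an identity, which gives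
  \<open>Ran u \<preceq> Ran v\<close>. Then \<open>u\<close> and the corestriction of \<open>v\<close> to \<open>Ran u\<close> have the same
  range and, by rigidity in \<open>H\<close>, the same image; star-injectivity, applied to their inverses,
  shows that they are equal.
\<close>

lemma incl_Leq:
  assumes uv: "u \<in> Arr U" "v \<in> Arr U"
  shows "i u \<preceq>\<^bsub>T\<^esub> i v \<longleftrightarrow> u \<preceq>\<^bsub>U\<^esub> v"
proof
  assume "u \<preceq>\<^bsub>U\<^esub> v"
  then show "i u \<preceq>\<^bsub>T\<^esub> i v"
    using uv by (simp add: incl_eq Leq_T tens_leI Ident_in_box map_Leq U.Ran_mono U.gsimps)
next
  assume "i u \<preceq>\<^bsub>T\<^esub> i v"
  then have le: "\<psi> u \<preceq>\<^bsub>H\<^esub> \<psi> v" "tens_le U H (Ran U u \<otimes> \<psi> (Ran U u)) (Ran U v \<otimes> \<psi> (Ran U v))"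
    using uv by (simp_all add: incl_eq Leq_T)
  have box_u: "(Ran U u, \<psi> (Ran U u)) \<in> box U H \<psi>"
    using uv by (simp add: Ident_in_box U.gsimps)
  obtain x l where x: "(x, l) \<in> box U H \<psi>" "x \<otimes> l = Ran U u \<otimes> \<psi> (Ran U u)"
    "x \<preceq>\<^bsub>U\<^esub> Ran U v" "l \<preceq>\<^bsub>H\<^esub> \<psi> (Ran U v)"
    using tens_leE[OF le(2) box_u] uv by (auto simp: Ident_in_box U.gsimps)
  have l: "l \<in> Idents H"
    using x uv H.below_Ident[of l "\<psi> (Ran U v)"] by (simp add: box_iff map_Idents U.gsimps)
  obtain w where w: "w \<in> Arr U" "Dom U w = x" "Ran U w = Ran U u" "l = \<psi> w \<cdot>\<^bsub>H\<^esub> \<psi> (Ran U u)"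
    using x box_u by (auto simp: tens_eq_iff)
  then have "\<psi> w = l" using map_Comp[of w "Ran U u"] uv by (metis U.Comp_Ran U.Dom_Ran U.Ran_closed)
  then have "w \<in> Idents U" using w l Ident_if_map_Ident by blast
  then have "x = Ran U u" using w by (metis U.Dom_Ident U.Ran_Ident)
  with x have ran: "Ran U u \<preceq>\<^bsub>U\<^esub> Ran U v" by simp
  let ?w = "corestr U v (Ran U u)"
  have w': "?w \<in> Arr U" "?w \<preceq>\<^bsub>U\<^esub> v" "Ran U ?w = Ran U u"
    using uv ran by (simp_all add: U.restr_simps U.gsimps)
  have "\<psi> ?w = \<psi> u"
    by (rule H.eq_if_le_and_Ran_eq[of _ _ "\<psi> v"])
      (use w' uv le in \<open>simp_all add: map_closed map_Leq flip: map_Ran\<close>)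
  with w' uv have "Inv U ?w = Inv U u"
    using arrow_eqI[of "Inv U ?w" "Inv U u"] by (simp add: map_Inv U.gsimps)
  then have "?w = u" using w' uv U.Inv_Inv by metis
  then show "u \<preceq>\<^bsub>U\<^esub> v" using w' by simp
qed

lemma ordered_embedding_incl: "ordered_embedding U T i"
proof -
  have "ordered_functor U T i"
  proof
    fix u v assume "u \<in> Arr U" "v \<in> Arr U" "Ran U u = Dom U v"
    then show "i (u \<cdot>\<^bsub>U\<^esub> v) = i u \<cdot>\<^bsub>T\<^esub> i v"
      by (simp add: incl_eq Comp_T map_Comp U.gsimps)
  qed (simp_all add: incl_closed incl_Dom incl_Ran incl_Leq)
  moreover have "inj_on i (Arr U)"
  proof (rule inj_onI)
    fix u v assume "u \<in> Arr U" "v \<in> Arr U" "i u = i v"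
    then show "u = v"
      using incl_Leq[of u v] incl_Leq[of v u] U.Leq_antisym[of u v] T.Leq_refl[of "i v"]
      by (simp add: incl_closed)
  qed
  ultimately show ?thesis by (simp add: ordered_embedding_def incl_Leq)
qed

text \<open>
  If \<open>k\<close> moves \<open>e \<otimes> \<psi> e\<close> to \<open>f \<otimes> \<psi> f\<close>, then \<open>f \<otimes> k\<^sup>-\<^sup>1 = e \<otimes> \<psi> e\<close>, and
  the arrow of \<open>U\<close> that witnesses this equality of classes maps to \<open>k\<^sup>-\<^sup>1\<close>.
\<close>

lemma incl_full:
  assumes t: "t \<in> Arr T" and e: "e \<in> Idents U" "Dom T t = i e" and f: "f \<in> Idents U" "Ran T t = i f"
  shows "t \<in> i ` Arr U"
proof -
  obtain k X where kX: "t = (k, X)" by (cases t)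
  have k: "k \<in> Arr H" "X = f \<otimes> \<psi> f" "Ran H k = \<psi> f"
    using t f kX by (auto simp: Ran_T incl_Ident elim: ArrT_E)
  have \<psi>f: "Ran H (\<psi> f) = \<psi> f" "\<psi> f \<in> Arr H" using f map_Idents by (simp_all add: H.gsimps)
  have "Dom T t = (Dom H k, f \<otimes> (\<psi> f \<cdot>\<^bsub>H\<^esub> Inv H k))"
    using kX k f \<psi>f by (simp add: Dom_T Ident_in_box)
  moreover have "\<psi> f \<cdot>\<^bsub>H\<^esub> Inv H k = Inv H k"
    using H.Comp_Dom[of "Inv H k"] k(1,3) by (simp add: H.inverse_simps)
  ultimately have "(Dom H k, f \<otimes> Inv H k) = (\<psi> e, e \<otimes> \<psi> e)"
    using e(2) incl_Ident[OF e(1)] by (simp only:)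
  then have dom: "Dom H k = \<psi> e" "f \<otimes> Inv H k = e \<otimes> \<psi> e"
    unfolding prod.inject by (rule conjunct1, rule conjunct2)
  have "(f, Inv H k) \<in> box U H \<psi>" using f k by (simp add: box_iff H.gsimps)
  then obtain u where u: "u \<in> Arr U" "Dom U u = f" "Ran U u = e" "Inv H k = \<psi> u \<cdot>\<^bsub>H\<^esub> \<psi> e"
    using dom(2) tens_eq_iff[OF _ Ident_in_box[OF e(1)]] by blast
  then have "Inv H k = \<psi> u"
    using map_Comp[of u e] e by (simp add: U.gsimps)
  then have "k = \<psi> (Inv U u)" using k u by (metis H.Inv_Inv map_Inv)
  then have "t = i (Inv U u)" using u k kX by (simp add: incl_eq U.gsimps)
  then show ?thesis using u by (simp add: U.gsimps)
qed

lemma enlargement_map_incl: "enlargement_map U T i"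
proof -
  interpret i: ordered_functor U T i
    using ordered_embedding_incl by (simp add: ordered_embedding_def)
  have Idents_image: "\<exists>e \<in> Idents U. t = i e" if t: "t \<in> i ` Arr U" "t \<in> Idents T" for t
  proof -
    obtain u where "u \<in> Arr U" "t = i u" using t(1) by blast
    moreover have "Dom T t = t" using t(2) by (simp add: Idents_def)
    ultimately show ?thesis
      using incl_Dom[of u] by (intro bexI[of _ "Dom U u"]) (simp_all add: U.Dom_in_Idents)
  qed
  have "subgroupoid (i ` Arr U) T"
    unfolding subgroupoid_def
  proof (intro conjI ballI impI)
    show "i ` Arr U \<subseteq> Arr T" using incl_closed by blast
  next
    fix t assume "t \<in> i ` Arr U"
    then show "Dom T t \<in> i ` Arr U" "Ran T t \<in> i ` Arr U" "Inv T t \<in> i ` Arr U"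
      by (auto simp: U.gsimps simp flip: incl_Dom incl_Ran i.map_Inv)
  next
    fix s t assume st: "s \<in> i ` Arr U" "t \<in> i ` Arr U" "Ran T s = Dom T t"
    then obtain u v where uv: "u \<in> Arr U" "v \<in> Arr U" "s = i u" "t = i v" by blast
    then have "i (Ran U u) = i (Dom U v)" using st by (simp add: incl_Ran incl_Dom)
    then have "Ran U u = Dom U v"
      using ordered_embedding_incl uv by (auto simp: ordered_embedding_def inj_on_def U.gsimps)
    then show "s \<cdot>\<^bsub>T\<^esub> t \<in> i ` Arr U"
      using uv by (auto simp: U.gsimps simp flip: i.map_Comp)
  qed
  moreover have "t \<in> i ` Arr U"
    if A: "s \<in> i ` Arr U \<inter> Idents T" and t: "t \<in> Idents T" "t \<preceq>\<^bsub>T\<^esub> s" for s t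
  proof -
    obtain e where e: "e \<in> Idents U" "s = i e" using A Idents_image by blast
    obtain f h where f: "t = (Ran H h, f \<otimes> h)" "(f, h) \<in> box U H \<psi>"
      using t(1) by (elim Idents_T_E)
    have "tens_le U H (f \<otimes> h) (e \<otimes> \<psi> e)"
      using t(2) e f by (simp add: incl_Ident Leq_T)
    then obtain x l where x: "(x, l) \<in> box U H \<psi>" "x \<otimes> l = f \<otimes> h" "l \<preceq>\<^bsub>H\<^esub> \<psi> e"
      using tens_leE[OF _ f(2) Ident_in_box[OF e(1)]] by blast
    have "l \<in> Idents H"
      using x e H.below_Ident[of l "\<psi> e"] by (simp add: box_iff map_Idents)
    then have "l = \<psi> x" "Ran H l = l" using x by (simp_all add: box_iff H.gsimps)
    moreover have "Ran H h = Ran H l" using tens_eq_Ran[OF x(1) f(2) x(2)] by simp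
    ultimately have "t = i x" using x f by (simp add: incl_Ident box_iff)
    then show ?thesis using x by (auto simp: box_iff U.gsimps)
  qed
  moreover have "t \<in> i ` Arr U"
    if t: "t \<in> Arr T" "Dom T t \<in> i ` Arr U" "Ran T t \<in> i ` Arr U" for t
    using incl_full[OF t(1)] Idents_image[OF t(2)] Idents_image[OF t(3)] t(1)
    by (auto simp: T.Dom_in_Idents T.Ran_in_Idents)
  moreover have "\<exists>t \<in> Arr T. Dom T t = d \<and> Ran T t \<in> i ` Arr U \<inter> Idents T"
    if id: "d \<in> Idents T" for d
  proof -
    obtain e h where d: "d = (Ran H h, e \<otimes> h)" "(e, h) \<in> box U H \<psi>"
      using id by (elim Idents_T_E)
    then have e: "e \<in> Idents U" "h \<in> Arr H" "Dom H h = \<psi> e" by (simp_all add: box_iff)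
    have \<psi>e: "Ran H (\<psi> e) = \<psi> e" using e map_Idents by (simp add: H.gsimps)
    \<comment> \<open>The inverse of the formal lift of \<open>h\<close>: it leads from \<open>e \<otimes> h\<close> back to \<open>e\<close>.\<close>
    let ?t = "(Inv H h, e \<otimes> \<psi> e)"
    have "?t \<in> Arr T" "Ran T ?t = i e"
      using e \<psi>e by (simp_all add: pair_in_Arr_T Ident_in_box Ran_T incl_Ident H.gsimps)
    moreover have "Dom T ?t = d"
      using e \<psi>e d Ident_in_box[OF e(1)] by (simp add: Dom_T H.gsimps map_Idents)
    ultimately show ?thesis using e incl_Idents by (intro bexI[of _ ?t]) (auto simp: U.gsimps)
  qed
  ultimately have "enlargement (i ` Arr U) T"
    unfolding enlargement_def using ordered_groupoid_T by blast
  then show ?thesis using ordered_embedding_incl by (simp add: enlargement_map_def)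
qed

end

section \<open>The factorization\<close>

theorem corollary4p5:
  fixes G :: "'a ogpd" and H :: "'b ogpd" and \<phi> :: "'a \<Rightarrow> 'b"
  assumes "ordered_groupoid G" and "ordered_groupoid H"
    and "ordered_functor G H \<phi>"
  shows
    "let A = kernel G H \<phi>;
         U = quot G A;
         \<omega> = qclass G A;
         \<psi> = induced \<phi>;
         Ht = Htilde U H \<psi>;
         i = incl U H \<psi>;
         \<pi> = fst
     in (\<forall>g \<in> Arr G. \<psi> (\<omega> g) = \<phi> g) \<and>
        ordered_functor U H \<psi> \<and> star_injective U \<psi> \<and>
        fibration G U \<omega> \<and>
        enlargement_map U Ht i \<and>
        covering Ht H \<pi> \<and>
        (\<forall>g \<in> Arr G. \<pi> (i (\<omega> g)) = \<phi> g)"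
proof -
  interpret ordered_functor G H \<phi> by (rule assms(3))
  interpret \<psi>: star_injective_functor Q H "induced \<phi>"
    by (intro star_injective_functor.intro ordered_groupoid_Q assms(2) ordered_functor_induced
        star_injective_functor_axioms.intro star_injective_induced)
  have "fst (incl Q H (induced \<phi>) (cls g)) = \<phi> g" if "g \<in> Arr G" for g
    using that by (simp add: incl_def map_cls)
  then show ?thesis
    unfolding Let_def
    by (intro conjI ballI map_cls ordered_functor_induced star_injective_induced fibration_cls
        \<psi>.enlargement_map_incl \<psi>.covering_fst)
qed

end
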